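(* Let $g\geq1$. Let $\mathbf{H}_g=\{z=x+iy\in M(g,\mathbf{C}): {}^tz=z,\ y \text{ positive definite}\}$ be the Siegel upper half-space, on which $\Gamma_g=\mathrm{Sp}(2g,\mathbf{Z})$ acts by $\gamma\cdot z=(az+b)(cz+d)^{-1}$, where $\gamma=\begin{pmatrix}a&b\\c&d\end{pmatrix}$ with $g\times g$ integer blocks. Let $A_g$ be the set of symmetric positive-definite $g\times g$ real matrices with integer diagonal entries and half-integer off-diagonal entries, let $$\Gamma_\infty=\Bigl\{\pm\begin{pmatrix}1&s\\0&1\end{pmatrix}: s\in M(g,\mathbf{Z}),\ s={}^ts\Bigr\},$$ and $e(w)=\exp(2\pi i w)$. For an even integer $k>2g$ and $s\in A_g$, define the Poincar\'e series $$\mathcal{P}_{s,k}(z)=\sum_{\gamma\in\Gamma_\infty\backslash\Gamma_g}\det(cz+d)^{-k}\,e(\mathrm{Tr}(s\,(\gamma\cdot z))),$$ which converges absolutely and uniformly on compact subsets of $\mathbf{H}_g$ and is a Siegel cusp form of weight $k$ for $\Gamma_g$, with Fourier expansion $\mathcal{P}_{s,k}(z)=\sum_{t\in A_g}p_{s,k}(t)e(\mathrm{Tr}(tz))$. Then for any fixed $s,t\in A_g$, $$\lim_{k\to+\infty}p_{s,k}(t)=\delta'(s,t)\frac{|\mathrm{Aut}(s)|}{2},$$ where the limit is over even $k$, $\delta'(s,t)$ equals $1$ if $t={}^ta\,s\,a$ for some $a\in\mathrm{GL}(g,\mathbf{Z})$ and $0$ otherwise, and $\mathrm{Aut}(s)=O(s,\mathbf{Z})=\{a\in\mathrm{GL}(g,\mathbf{Z}):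 {}^ta\,s\,a=s\}$. *)

theory Defs
  imports "HOL-Analysis.Analysis"
begin

text \<open>
  The degree \<open>g \<ge> 1\<close> is \<open>CARD('n)\<close>: a \<open>g \<times> g\<close> matrix has type \<open>'a^'n^'n\<close>, and a
  \<open>2g \<times> 2g\<close> matrix has type \<open>'a^('n+'n)^('n+'n)\<close>, its four blocks being selected by
  \<^const>\<open>Inl\<close> and \<^const>\<open>Inr\<close>.
\<close>

definition block_matrix ::
  "'a^'n^'n \<Rightarrow> 'a^'n^'n \<Rightarrow> 'a^'n^'n \<Rightarrow> 'a^'n^'n \<Rightarrow> 'a^('n::finite + 'n)^('n + 'n)" where
  "block_matrix a b c d = (\<chi> i j.
     case i of
       Inl i' \<Rightarrow> (case j of Inl j' \<Rightarrow> a $ i' $ j' | Inr j' \<Rightarrow> b $ i' $ j')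
     | Inr i' \<Rightarrow> (case j of Inl j' \<Rightarrow> c $ i' $ j' | Inr j' \<Rightarrow> d $ i' $ j'))"

definition block_a :: "'a^('n::finite + 'n)^('n + 'n) \<Rightarrow> 'a^'n^'n" where
  "block_a M = (\<chi> i j. M $ Inl i $ Inl j)"

definition block_b :: "'a^('n::finite + 'n)^('n + 'n) \<Rightarrow> 'a^'n^'n" where
  "block_b M = (\<chi> i j. M $ Inl i $ Inr j)"

definition block_c :: "'a^('n::finite + 'n)^('n + 'n) \<Rightarrow> 'a^'n^'n" where
  "block_c M = (\<chi> i j. M $ Inr i $ Inl j)"

definition block_d :: "'a^('n::finite + 'n)^('n + 'n) \<Rightarrow> 'a^'n^'n" where
  "block_d M = (\<chi> i j. M $ Inr i $ Inr j)"

definition pos_def_matrix :: "real^'n^'n \<Rightarrow> bool" where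
  "pos_def_matrix y \<longleftrightarrow> transpose y = y \<and> (\<forall>v. v \<noteq> 0 \<longrightarrow> v \<bullet> (y *v v) > 0)"

definition siegel_half_space :: "(complex^'n^'n) set" where
  "siegel_half_space = {z. transpose z = z \<and> pos_def_matrix (map_matrix Im z)}"

definition Sp_int :: "(int^('n::finite + 'n)^('n + 'n)) set" where
  "Sp_int = {M. transpose M ** block_matrix 0 (mat 1) (- mat 1) 0 ** M
                = block_matrix 0 (mat 1) (- mat 1) 0}"

definition automorphy_matrix ::
  "int^('n::finite + 'n)^('n + 'n) \<Rightarrow> complex^'n^'n \<Rightarrow> complex^'n^'n" where
  "automorphy_matrix M z =
     map_matrix of_int (block_c M) ** z + map_matrix of_int (block_d M)"

definition siegel_action ::
  "int^('n::finite + 'n)^('n + 'n) \<Rightarrow> complex^'n^'n \<Rightarrow> complex^'n^'n" where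
  "siegel_action M z =
     (map_matrix of_int (block_a M) ** z + map_matrix of_int (block_b M))
     ** matrix_inv (automorphy_matrix M z)"

definition Gamma_infinity :: "(int^('n::finite + 'n)^('n + 'n)) set" where
  "Gamma_infinity =
     {block_matrix (mat 1) S 0 (mat 1) | S. transpose S = S}
     \<union> {- block_matrix (mat 1) S 0 (mat 1) | S. transpose S = S}"

definition left_coset_rel ::
  "((int^('n::finite + 'n)^('n + 'n)) \<times> (int^('n + 'n)^('n + 'n))) set" where
  "left_coset_rel =
     {(M, N). M \<in> Sp_int \<and> N \<in> Sp_int \<and> (\<exists>u\<in>Gamma_infinity. N = u ** M)}"

text \<open>Here ``half-integer'' means an element of \<open>(1/2)\<int>\<close>, integers included.\<close>

definition half_integral_pos_def :: "(real^'n^'n) set" where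
  "half_integral_pos_def =
     {s. pos_def_matrix s \<and> (\<forall>i. s $ i $ i \<in> \<int>) \<and> (\<forall>i j. i \<noteq> j \<longrightarrow> 2 * s $ i $ j \<in> \<int>)}"

definition e_char :: "complex \<Rightarrow> complex" where
  "e_char w = exp (2 * of_real pi * \<i> * w)"

definition tr_char :: "real^'n^'n \<Rightarrow> complex^'n^'n \<Rightarrow> complex" where
  "tr_char s z = e_char (trace (map_matrix of_real s ** z))"

text \<open>
  A term of the Poincare series is attached to a coset through an arbitrary representative; for
  \<open>k\<close> even, \<open>s\<close> half-integral and \<open>z\<close> in the half-space the value does not depend on that choice.
\<close>

definition poincare_series :: "real^'n^'n \<Rightarrow> nat \<Rightarrow> complex^'n^'n \<Rightarrow> complex" where
  "poincare_series s k z =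
     (\<Sum>\<^sub>\<infinity>C \<in> Sp_int // left_coset_rel.
        (let M = (SOME M. M \<in> C)
         in det (automorphy_matrix M z) powi (- int k) * tr_char s (siegel_action M z)))"

definition has_fourier_expansion ::
  "(complex^'n^'n \<Rightarrow> complex) \<Rightarrow> (real^'n^'n \<Rightarrow> complex) \<Rightarrow> bool" where
  "has_fourier_expansion F p \<longleftrightarrow>
     (\<forall>z\<in>siegel_half_space. ((\<lambda>t. p t * tr_char t z) has_sum F z) half_integral_pos_def)"

text \<open>
  \<open>GL(g, \<int>)\<close> is the set of \<^const>\<open>invertible\<close> matrices over \<^typ>\<open>int\<close>, that is, those with an
  integral inverse.
\<close>

definition gl_conj :: "int^'n^'n \<Rightarrow> real^'n^'n \<Rightarrow> real^'n^'n" where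
  "gl_conj a s = transpose (map_matrix of_int a) ** s ** map_matrix of_int a"

definition delta' :: "real^'n^'n \<Rightarrow> real^'n^'n \<Rightarrow> real" where
  "delta' s t = (if \<exists>a. invertible a \<and> t = gl_conj a s then 1 else 0)"

definition Aut :: "real^'n^'n \<Rightarrow> (int^'n^'n) set" where
  "Aut s = {a. invertible a \<and> gl_conj a s = s}"

end

theory Submission
  imports Defs "HOL-Computational_Algebra.Fundamental_Theorem_Algebra"
begin

text \<open>
  Everything takes place on the points \<open>z = x + 2i\<close> with \<open>x\<close> real symmetric.  The cosets with
  \<open>c = 0\<close> correspond to \<open>GL(g, \<int>)/\<plusminus>1\<close>; their terms do not depend on \<open>k\<close> and sum to the Fourier
  series with coefficients \<open>\<bar>{a. \<^sup>ta s a = t}\<bar>/2\<close>.  For \<open>c \<noteq> 0\<close> one has \<open>\<bar>det (c z + d)\<bar> \<ge> 2\<close>, so the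
  remaining terms lose a factor \<open>2\<close> each time \<open>k\<close> grows by one, and by periodicity their sum is
  \<open>O(2\<^sup>-\<^sup>k)\<close> uniformly in \<open>x\<close>.  The \<open>t\<close>-th Fourier coefficient is bounded by the supremum over \<open>x\<close>.

  Absolute convergence is only needed for one large weight \<open>k = 4 g\<^sup>2\<close>, where the exponential factor
  reduces it to a sum over all pairs of integer matrices \<open>(c, d)\<close>.
\<close>

text \<open>Height 2 is one choice of l > 1: for c nonzero the bound proved on x + il is
  \<open>norm (det (c z + d)) >= l\<close>, for every \<open>l >= 1\<close>. The obstacle is
  uniformity in (c, d) and in x. On the vertical line over x the determinant is a polynomial in the
  height parameter with real roots only, so its size at height l is controlled by its behaviour at
  infinity, and there integrality of c and d gives a lower bound independent of all data. The weight
  4 g^2 reflects the 2 g^2 integer entries of (c, d), each summed against an inverse square.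
  Recovering d from c z + d costs a bound on c x, so the convergence estimate is proved for bounded
  x and carried over by periodicity. Summability has to be established before the cosets with c = 0
  can be split off, because the series is an \<open>infsum\<close>. Two-point averages take the
  place of an integral over a torus, so the Fourier expansion enters only through
  \<open>has_sum\<close> at the points of height 2.\<close>

section \<open>Fourier coefficients of bounded almost periodic series\<close>

text \<open>
  A coefficient \<open>q a\<close> is removed by averaging \<open>G\<close> with its translate by some \<open>X\<close> satisfying
  \<open>(a - t) \<bullet> X = 1/2\<close>, twisted so that \<open>q t\<close> is unchanged.
\<close>

lemma norm_coeff_le_plus_tail:
  fixes t :: "'a::real_inner" and q :: "'a \<Rightarrow> complex"
  assumes V: "subspace V" and A: "A \<subseteq> V" "t \<in> A"
    and "finite T" "T \<subseteq> A - {t}"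
    and "(\<lambda>u. norm (q u)) summable_on A"
    and "\<And>x. x \<in> V \<Longrightarrow> ((\<lambda>u. q u * cis (2 * pi * (u \<bullet> x))) has_sum G x) A"
    and "\<And>x. x \<in> V \<Longrightarrow> norm (G x) \<le> E"
  shows "norm (q t) \<le> E + (\<Sum>\<^sub>\<infinity>u\<in>A - insert t T. norm (q u))"
  using assms(4-)
proof (induction T arbitrary: q G rule: finite_induct)
  case empty
  have "(q has_sum G 0) A"
    using empty(3)[of 0] V by (simp add: subspace_0)
  moreover have sm: "(\<lambda>u. norm (q u)) summable_on A - {t}"
    using empty(2) by (rule summable_on_subset_banach) auto
  have "(q has_sum infsum q (A - {t})) (A - {t})"
    using Infinite_Sum.abs_summable_summable[OF sm] by (rule has_sum_infsum)
  then have "(q has_sum (q t + infsum q (A - {t}))) (insert t (A - {t}))"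
    by (intro has_sum_insert) auto
  then have "(q has_sum (q t + infsum q (A - {t}))) A"
    using A by (simp add: insert_absorb)
  ultimately have "q t = G 0 - infsum q (A - {t})"
    using has_sum_unique by fastforce
  then have "norm (q t) \<le> norm (G 0) + norm (infsum q (A - {t}))"
    by (simp add: norm_triangle_ineq4)
  also have "\<dots> \<le> E + (\<Sum>\<^sub>\<infinity>u\<in>A - {t}. norm (q u))"
    using empty(4)[of 0] V norm_infsum_bound[OF sm] by (intro add_mono) (auto simp: subspace_0)
  finally show ?case by simp
next
  case (insert a T)
  define X where "X = (1 / (2 * ((a - t) \<bullet> (a - t)))) *\<^sub>R (a - t)"
  \<comment> \<open>The twist multiplies the coefficient at \<open>u\<close> by \<open>m u\<close>,
    of modulus at most 1, with \<open>m t = 1\<close> and \<open>m a = 0\<close>. The bound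
    \<open>E\<close> survives because \<open>G'\<close> is the mean of \<open>G\<close> and a
    translate of \<open>G\<close> times a unimodular constant.\<close>
  define m where "m u = (1 + cis (2 * pi * ((u - t) \<bullet> X))) / 2" for u
  define q' where "q' u = q u * m u" for u
  define G' where "G' x = (G x + cis (- (2 * pi * (t \<bullet> X))) * G (x + X)) / 2" for x
  have XV: "X \<in> V"
    unfolding X_def using V A insert.prems(1) by (intro subspace_scale subspace_diff) auto
  have "a \<noteq> t" using insert.prems by auto
  then have "(a - t) \<bullet> X = 1 / 2" by (simp add: X_def)
  then have "2 * pi * ((a - t) \<bullet> X) = pi" by simp
  then have ma: "m a = 0" unfolding m_def by (simp only:) simp
  have "norm (m u) \<le> 1" for u
    using norm_triangle_ineq[of 1 "cis (2 * pi * ((u - t) \<bullet> X))"] by (simp add: m_def norm_divide)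
  then have nq: "norm (q' u) \<le> norm (q u)" for u
    unfolding q'_def norm_mult by (simp add: mult_left_le)
  have sm': "(\<lambda>u. norm (q' u)) summable_on A"
    using insert.prems(2) nq by (rule Infinite_Sum.abs_summable_on_comparison_test)
  have hs': "((\<lambda>u. q' u * cis (2 * pi * (u \<bullet> x))) has_sum G' x) A" if x: "x \<in> V" for x
  proof -
    have "((\<lambda>u. (q u * cis (2 * pi * (u \<bullet> x)) +
        cis (- (2 * pi * (t \<bullet> X))) * (q u * cis (2 * pi * (u \<bullet> (x + X))))) * (1 / 2))
        has_sum (G x + cis (- (2 * pi * (t \<bullet> X))) * G (x + X)) * (1 / 2)) A"
      by (intro has_sum_cmult_left has_sum_add has_sum_cmult_right insert.prems x subspace_add V XV)
    moreover have "(q u * cis (2 * pi * (u \<bullet> x)) +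
        cis (- (2 * pi * (t \<bullet> X))) * (q u * cis (2 * pi * (u \<bullet> (x + X))))) * (1 / 2)
        = q' u * cis (2 * pi * (u \<bullet> x))" for u
    proof -
      have "cis (- (2 * pi * (t \<bullet> X))) * cis (2 * pi * (u \<bullet> (x + X)))
          = cis (2 * pi * ((u - t) \<bullet> X)) * cis (2 * pi * (u \<bullet> x))"
        by (simp add: cis_mult algebra_simps inner_add inner_diff)
      then show ?thesis
        unfolding q'_def m_def by (simp add: field_simps)
    qed
    ultimately show ?thesis unfolding G'_def by simp
  qed
  have G'E: "norm (G' x) \<le> E" if x: "x \<in> V" for x
  proof -
    have "norm (G' x) \<le> (norm (G x) + norm (G (x + X))) / 2"
      unfolding G'_def norm_divide
      using norm_triangle_ineq[of "G x" "cis (- (2 * pi * (t \<bullet> X))) * G (x + X)"]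
      by (simp add: norm_mult)
    then show ?thesis
      using insert.prems(4)[OF x] insert.prems(4)[OF subspace_add[OF V x XV]] by simp
  qed
  have "norm (q' t) \<le> E + (\<Sum>\<^sub>\<infinity>u\<in>A - insert t T. norm (q' u))"
    using insert.prems(1) by (intro insert.IH[OF _ sm' hs' G'E]) auto
  also have "(\<Sum>\<^sub>\<infinity>u\<in>A - insert t T. norm (q' u)) = (\<Sum>\<^sub>\<infinity>u\<in>A - insert t (insert a T). norm (q' u))"
    by (rule infsum_cong_neutral) (auto simp: q'_def ma)
  also have "\<dots> \<le> (\<Sum>\<^sub>\<infinity>u\<in>A - insert t (insert a T). norm (q u))"
    using sm' insert.prems(2)
    by (intro infsum_mono nq; elim summable_on_subset_banach) auto
  finally show ?case by (simp add: q'_def m_def)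
qed

text \<open>A finite set of frequencies carries all but \<open>e\<close> of the absolutely
  convergent sum of coefficients; annihilating the coefficients on it, except the one at
  \<open>t\<close>, leaves a tail of at most \<open>e\<close>.\<close>

lemma norm_coeff_le:
  fixes t :: "'a::real_inner" and q :: "'a \<Rightarrow> complex"
  assumes V: "subspace V" and A: "A \<subseteq> V" "t \<in> A"
    and hs: "\<And>x. x \<in> V \<Longrightarrow> ((\<lambda>u. q u * cis (2 * pi * (u \<bullet> x))) has_sum G x) A"
    and E: "\<And>x. x \<in> V \<Longrightarrow> norm (G x) \<le> E"
  shows "norm (q t) \<le> E"
proof (rule field_le_epsilon)
  fix e :: real assume "e > 0"
  have "(q has_sum G 0) A"
    using hs[of 0] V by (simp add: subspace_0)
  then have sm: "(\<lambda>u. norm (q u)) summable_on A"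
    using summable_on_iff_abs_summable_on_complex has_sum_imp_summable by blast
  obtain F where F: "finite F" "F \<subseteq> A" "dist (\<Sum>u\<in>F. norm (q u)) (\<Sum>\<^sub>\<infinity>u\<in>A. norm (q u)) \<le> e"
    using infsum_finite_approximation[OF sm \<open>e > 0\<close>] by blast
  have smF: "(\<lambda>u. norm (q u)) summable_on (A - F)" for F
    using sm by (rule summable_on_subset_banach) auto
  have "norm (q t) \<le> E + (\<Sum>\<^sub>\<infinity>u\<in>A - insert t (F - {t}). norm (q u))"
    using F by (intro norm_coeff_le_plus_tail[OF V A _ _ sm hs E]) auto
  also have "(\<Sum>\<^sub>\<infinity>u\<in>A - insert t (F - {t}). norm (q u)) \<le> (\<Sum>\<^sub>\<infinity>u\<in>A - F. norm (q u))"
    by (rule infsum_mono_neutral) (auto intro: smF)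
  also have "(\<Sum>\<^sub>\<infinity>u\<in>A. norm (q u)) = (\<Sum>\<^sub>\<infinity>u\<in>F. norm (q u)) + (\<Sum>\<^sub>\<infinity>u\<in>A - F. norm (q u))"
    using infsum_Un_disjoint[of "\<lambda>u. norm (q u)" F "A - F"] F smF by (simp add: Un_absorb1)
  then have "(\<Sum>\<^sub>\<infinity>u\<in>A - F. norm (q u)) \<le> e"
    using F by (simp add: dist_real_def)
  finally show "norm (q t) \<le> E + e" by simp
qed

section \<open>Determinant bounds and summation over integer matrices\<close>

lemma norm_det_le:
  fixes A :: "complex^'n^'n"
  assumes "\<And>i j. norm (A $ i $ j) \<le> B"
  shows "norm (det A) \<le> fact CARD('n) * B ^ CARD('n)"
proof -
  have "norm (det A) \<le> (\<Sum>p | p permutes (UNIV::'n set). B ^ CARD('n))"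
    unfolding det_def
  proof (rule sum_norm_le)
    fix p assume "p \<in> {p. p permutes (UNIV::'n set)}"
    have "norm (of_int (sign p) :: complex) = 1"
      by (metis abs_sign norm_of_int of_int_1 of_int_abs)
    then have "norm (of_int (sign p) * (\<Prod>i\<in>UNIV. A $ i $ p i)) = (\<Prod>i\<in>UNIV. norm (A $ i $ p i))"
      by (simp add: norm_mult prod_norm)
    also have "\<dots> \<le> (\<Prod>i\<in>(UNIV::'n set). B)"
      using assms by (intro prod_mono) auto
    finally show "norm (of_int (sign p) * (\<Prod>i\<in>UNIV. A $ i $ p i)) \<le> B ^ CARD('n)" by simp
  qed
  then show ?thesis by (simp add: card_permutations)
qed

text \<open>Cramer's rule for the system with matrix \<open>v\<close> whose solution is column
  \<open>j\<close> of \<open>w\<close>: replacing a column of \<open>v\<close> by a unit vector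
  keeps all entries at most \<open>1 + R\<close>, and dividing by \<open>det v\<close> is
  multiplying by \<open>det w\<close>.\<close>

lemma norm_entry_le_det_mult:
  fixes v w :: "complex^'n^'n"
  assumes vw: "v ** w = mat 1" and v: "\<And>i j. norm (v $ i $ j) \<le> R"
  shows "norm (w $ i $ j) \<le> norm (det w) * (fact CARD('n) * (1 + R) ^ CARD('n))"
proof -
  have dvw: "det v * det w = 1" using vw by (metis det_I det_mul)
  then have dv: "det v \<noteq> 0" by auto
  have R: "0 \<le> R" using v[of undefined undefined] norm_ge_zero order_trans by blast
  let ?W = "(\<chi> k l. if l = i then axis j 1 $ k else v $ k $ l) :: complex^'n^'n"
  have "v *v column j w = axis j 1"
    using vw by (simp add: vec_eq_iff column_def matrix_vector_mult_def matrix_matrix_mult_def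
        mat_def axis_def)
  then have "column j w = (\<chi> k. det (\<chi> m l. if l = k then axis j 1 $ m else v $ m $ l) / det v)"
    using cramer[OF dv] by blast
  then have "w $ i $ j = det ?W / det v"
    by (simp add: vec_eq_iff column_def)
  also have "\<dots> = det w * det ?W"
    using dvw dv by (simp add: field_simps)
  finally have "norm (w $ i $ j) = norm (det w) * norm (det ?W)"
    by (simp add: norm_mult)
  also have "\<dots> \<le> norm (det w) * (fact CARD('n) * (1 + R) ^ CARD('n))"
  proof (intro mult_left_mono norm_det_le)
    fix k l
    show "norm (?W $ k $ l) \<le> 1 + R"
      using v[of k l] R by (auto simp: axis_def add_increasing)
  qed auto
  finally show ?thesis .
qed

text \<open>The right-hand side is that of the entry bound, so a single quantity dominates both 1
  and every entry of \<open>w\<close>.\<close>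

lemma one_le_det_mult:
  fixes v w :: "complex^'n^'n"
  assumes vw: "v ** w = mat 1" and v: "\<And>i j. norm (v $ i $ j) \<le> R"
  shows "1 \<le> norm (det w) * (fact CARD('n) * (1 + R) ^ CARD('n))"
proof -
  have R: "norm (v $ i $ j) \<le> 1 + R" for i j using v[of i j] by simp
  have "1 = norm (det v) * norm (det w)"
    by (metis vw det_I det_mul norm_mult norm_one)
  also have "\<dots> \<le> (fact CARD('n) * (1 + R) ^ CARD('n)) * norm (det w)"
    by (intro mult_right_mono norm_det_le R) auto
  finally show ?thesis by (simp add: mult.commute)
qed

lemma polynomial_gaussian_bound:
  fixes e :: real
  assumes "e > 0"
  obtains K where "\<And>r. 0 \<le> r \<Longrightarrow> (1 + r) ^ n * exp (- e * r\<^sup>2) \<le> K"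
proof -
  \<comment> \<open>The \<open>n\<close> factors \<open>exp (h * r^2)\<close> together must stay
    below \<open>exp (e * r^2)\<close>; the denominator \<open>n + 1\<close> keeps \<open>h\<close>
    positive also for \<open>n = 0\<close>.\<close>
  define h where "h = e / (n + 1)"
  have h: "h > 0" using assms by (simp add: h_def)
  have "(1 + r) ^ n * exp (- e * r\<^sup>2) \<le> (2 + 1 / h) ^ n" if r: "0 \<le> r" for r :: real
  proof -
    have "0 \<le> (r - 1)\<^sup>2" by simp
    then have "1 + r \<le> 2 + r\<^sup>2"
      using r by (simp add: power2_eq_square algebra_simps) 
    also have "\<dots> \<le> (2 + 1 / h) * (1 + h * r\<^sup>2)"
      using h by (simp add: field_simps add_increasing)
    also have "\<dots> \<le> (2 + 1 / h) * exp (h * r\<^sup>2)"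
      using h by (intro mult_left_mono) (auto simp: exp_ge_add_one_self)
    finally have "(1 + r) ^ n \<le> ((2 + 1 / h) * exp (h * r\<^sup>2)) ^ n"
      using r by (intro power_mono) auto
    also have "\<dots> = (2 + 1 / h) ^ n * exp (n * (h * r\<^sup>2))"
      by (simp add: power_mult_distrib exp_of_nat_mult)
    also have "\<dots> \<le> (2 + 1 / h) ^ n * exp (e * r\<^sup>2)"
    proof (intro mult_left_mono)
      have "n * h \<le> e" using assms by (simp add: h_def field_simps)
      then have "n * h * r\<^sup>2 \<le> e * r\<^sup>2" by (intro mult_right_mono) auto
      then show "exp (n * (h * r\<^sup>2)) \<le> exp (e * r\<^sup>2)" by (simp add: mult.assoc)
    qed (use h in auto)
    finally show ?thesis
      by (simp add: exp_minus field_simps)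
  qed
  then show thesis using that by blast
qed

section \<open>Summability over pairs of integer matrices\<close>

lemma prod_summable_on_functions:
  fixes f :: "int \<Rightarrow> real"
  assumes f: "f summable_on UNIV" "\<And>n. 0 \<le> f n"
  shows "(\<lambda>h. \<Prod>i\<in>UNIV. f (h i)) summable_on (UNIV :: ('i::finite \<Rightarrow> int) set)"
proof (rule nonneg_bdd_above_summable_on)
  show "bdd_above (sum (\<lambda>h. \<Prod>i\<in>UNIV. f (h i)) ` {F. F \<subseteq> UNIV \<and> finite (F::('i \<Rightarrow> int) set)})"
  proof (rule bdd_aboveI)
    fix y assume "y \<in> sum (\<lambda>h. \<Prod>i\<in>UNIV. f (h i)) ` {F. F \<subseteq> UNIV \<and> finite (F::('i \<Rightarrow> int) set)}"
    then obtain F :: "('i \<Rightarrow> int) set" where F: "finite F" "y = (\<Sum>h\<in>F. \<Prod>i\<in>UNIV. f (h i))"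
      by auto
    \<comment> \<open>A finite set of functions lies in the box of its coordinate projections; over
      a box the sum of products factorises, and each factor is at most the full sum of
      \<open>f\<close>.\<close>
    define B where "B i = (\<lambda>h. h i) ` F" for i
    have "F \<subseteq> PiE UNIV B" by (auto simp: B_def PiE_def)
    then have "y \<le> (\<Sum>h\<in>PiE UNIV B. \<Prod>i\<in>UNIV. f (h i))"
      unfolding F(2) using F(1) f(2)
      by (intro sum_mono2 prod_nonneg finite_PiE) (auto simp: B_def)
    also have "\<dots> = (\<Prod>i\<in>UNIV. \<Sum>n\<in>B i. f n)"
      using F(1) by (subst prod_sum_PiE) (auto simp: B_def)
    also have "\<dots> \<le> (\<Prod>i\<in>(UNIV::'i set). infsum f UNIV)"
      using F(1) f by (intro prod_mono conjI finite_sum_le_infsum sum_nonneg) (auto simp: B_def)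
    finally show "y \<le> (\<Prod>i\<in>(UNIV::'i set). infsum f UNIV)" .
  qed
qed (auto intro: prod_nonneg f)

lemma inverse_square_summable_on_int:
  "(\<lambda>n::int. 1 / (1 + \<bar>real_of_int n\<bar>)\<^sup>2) summable_on UNIV"
proof -
  have "summable (\<lambda>n. 1 / (real (Suc n))\<^sup>2)"
    using inverse_power_summable[of 2, where 'a = real]
    by (subst summable_Suc_iff) (auto simp: field_simps)
  then have nat: "(\<lambda>n. 1 / (1 + real n)\<^sup>2) summable_on UNIV"
    by (intro summable_nonneg_imp_summable_on) (auto simp: add.commute)
  have "(\<lambda>n::int. 1 / (1 + \<bar>real_of_int n\<bar>)\<^sup>2) summable_on (range int \<union> range (\<lambda>n. - int n))"
    by (intro summable_on_union; subst summable_on_reindex)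
       (auto simp: o_def inj_on_def nat)
  moreover have "range int \<union> range (\<lambda>n. - int n) = UNIV"
    by (metis (no_types, lifting) UNIV_eq_I UnI1 UnI2 int_cases2 rangeI)
  ultimately show ?thesis by simp
qed

lemma int_matrix_pair_weights_summable:
  "(\<lambda>(c, d). (\<Prod>i\<in>UNIV. \<Prod>j\<in>UNIV. 1 / (1 + \<bar>real_of_int (c $ i $ j)\<bar>)\<^sup>2) *
             (\<Prod>i\<in>UNIV. \<Prod>j\<in>UNIV. 1 / (1 + \<bar>real_of_int (d $ i $ j)\<bar>)\<^sup>2))
     summable_on (UNIV :: ((int^'n^'n) \<times> (int^'n^'n)) set)"
proof -
  let ?f = "\<lambda>n::int. 1 / (1 + \<bar>real_of_int n\<bar>)\<^sup>2"
  let ?w = "\<lambda>c::int^'n^'n. \<Prod>i\<in>UNIV. \<Prod>j\<in>UNIV. ?f (c $ i $ j)"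
  have "(\<lambda>h. \<Prod>p\<in>UNIV. ?f (h p)) summable_on (UNIV :: ('n \<times> 'n \<Rightarrow> int) set)"
    by (rule prod_summable_on_functions[OF inverse_square_summable_on_int]) auto
  then have "(\<lambda>h. \<Prod>p\<in>UNIV. ?f (h p)) summable_on range (\<lambda>(c::int^'n^'n) (i, j). c $ i $ j)"
    by (rule summable_on_subset_banach) auto
  then have "(\<lambda>c::int^'n^'n. \<Prod>p\<in>UNIV. ?f (case p of (i, j) \<Rightarrow> c $ i $ j)) summable_on UNIV"
    by (subst (asm) summable_on_reindex) (auto simp: inj_on_def fun_eq_iff vec_eq_iff o_def)
  then have w: "?w summable_on UNIV"
    by (simp add: prod.cartesian_product case_prod_unfold)
  have nn: "0 \<le> ?w c" for c by (intro prod_nonneg) auto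
  have "(\<lambda>p. norm (case p of (c, d) \<Rightarrow> ?w c * ?w d)) summable_on (UNIV :: (int^'n^'n) set) \<times> (UNIV :: (int^'n^'n) set)"
  proof (subst Infinite_Sum.abs_summable_on_Sigma_iff, intro conjI ballI)
    have "norm (?w c * ?w d) = ?w c * ?w d" for c d
      using nn by (simp only: real_norm_def abs_of_nonneg mult_nonneg_nonneg)
    then have *: "(norm (case (c, d) of (c, d) \<Rightarrow> ?w c * ?w d)) = ?w c * ?w d" for c d
      by simp
    show "(\<lambda>d. norm (case (c, d) of (c, d) \<Rightarrow> ?w c * ?w d)) summable_on UNIV" for c
      unfolding * by (intro summable_on_cmult_right w)
    have "0 \<le> infsum ?w UNIV" using nn by (intro infsum_nonneg) auto
    then have "norm (\<Sum>\<^sub>\<infinity>d\<in>UNIV. norm (case (c, d) of (c, d) \<Rightarrow> ?w c * ?w d)) = ?w c * infsum ?w UNIV" for c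
      unfolding * infsum_cmult_right' using nn[of c] by (simp only: real_norm_def abs_of_nonneg mult_nonneg_nonneg)
    then show "(\<lambda>c. norm (\<Sum>\<^sub>\<infinity>d\<in>UNIV. norm (case (c, d) of (c, d) \<Rightarrow> ?w c * ?w d))) summable_on UNIV"
      by (simp only:) (intro summable_on_cmult_left w)
  qed
  then have "(\<lambda>p. case p of (c, d) \<Rightarrow> ?w c * ?w d) summable_on (UNIV :: (int^'n^'n) set) \<times> (UNIV :: (int^'n^'n) set)"
    by (rule Infinite_Sum.abs_summable_summable)
  then show ?thesis by simp
qed

section \<open>Lower bound for the automorphy factor\<close>

text \<open>Divided by the matching power of its argument, the polynomial becomes its reflection
  evaluated at the inverse argument, which tends to 0.\<close>

lemma norm_poly_imaginary_axis_tendsto: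
  fixes p :: "complex poly"
  shows "((\<lambda>b. norm (poly p (\<i> * of_real b)) / b ^ degree p) \<longlongrightarrow> norm (lead_coeff p)) at_top"
proof -
  have "((\<lambda>b. inverse (\<i> * of_real b)) \<longlongrightarrow> 0) at_top"
    by (rule tendsto_norm_zero_cancel)
       (simp add: norm_inverse norm_mult tendsto_inverse_0_at_top filterlim_abs_real)
  then have "((\<lambda>b. norm (poly (reflect_poly p) (inverse (\<i> * of_real b)))) \<longlongrightarrow>
      norm (poly (reflect_poly p) 0)) at_top"
    by (intro tendsto_intros)
  moreover have "eventually (\<lambda>b. norm (poly (reflect_poly p) (inverse (\<i> * of_real b)))
      = norm (poly p (\<i> * of_real b)) / b ^ degree p) at_top"
    using eventually_gt_at_top[of 0]
    by eventually_elim
       (simp add: poly_reflect_poly_nz norm_mult norm_power norm_inverse divide_inverse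
          power_inverse mult.commute)
  ultimately show ?thesis by (simp add: tendsto_cong)
qed

text \<open>For a real root r, \<open>(l / b) * |ib - r| <= |il - r|\<close>, because
  \<open>l^2 * r^2 <= b^2 * r^2\<close>. The claim is the product of these inequalities, the roots
  being split off one at a time.\<close>

lemma norm_poly_real_roots_growth:
  fixes p :: "complex poly"
  assumes roots: "\<And>z. poly p z = 0 \<Longrightarrow> p \<noteq> 0 \<Longrightarrow> Im z = 0" and l: "0 < l" "l \<le> b"
  shows "(l / b) ^ degree p * norm (poly p (\<i> * of_real b)) \<le> norm (poly p (\<i> * of_real l))"
  using roots
proof (induction "degree p" arbitrary: p)
  case 0
  then obtain a where "p = [:a:]" by (metis degree_eq_zeroE)
  then show ?case by simp
next
  case (Suc n p)
  then have "\<not> constant (poly p)" by (simp add: constant_degree)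
  then obtain r where r: "poly p r = 0" using fundamental_theorem_of_algebra by blast
  then obtain q where q: "p = [:- r, 1:] * q" by (metis dvdE poly_eq_0_iff_dvd)
  have p0: "p \<noteq> 0" using Suc.hyps(2) by auto
  then have q0: "q \<noteq> 0" using q by auto
  have Imr: "Im r = 0" using Suc.prems r p0 by blast
  have dq: "degree p = Suc (degree q)"
    unfolding q using q0 by (subst degree_mult_eq) auto
  have h1: "(l / b) ^ degree q * norm (poly q (\<i> * of_real b)) \<le> norm (poly q (\<i> * of_real l))"
  proof (rule Suc.hyps(1))
    show "n = degree q" using Suc.hyps(2) dq by simp
    show "Im z = 0" if "poly q z = 0" for z
      using Suc.prems[of z] that p0 by (simp add: q)
  qed
  have h2: "(l / b) * norm (\<i> * of_real b - r) \<le> norm (\<i> * of_real l - r)"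
  proof -
    have "l\<^sup>2 * (Re r)\<^sup>2 \<le> b\<^sup>2 * (Re r)\<^sup>2"
      using l by (intro mult_right_mono power_mono) auto
    then have "(l * norm (\<i> * of_real b - r))\<^sup>2 \<le> (b * norm (\<i> * of_real l - r))\<^sup>2"
      using Imr by (simp add: power_mult_distrib cmod_power2 algebra_simps)
    then have "l * norm (\<i> * of_real b - r) \<le> b * norm (\<i> * of_real l - r)"
      by (rule power2_le_imp_le) (use l in simp)
    then show ?thesis using l by (simp add: field_simps)
  qed
  have "((l / b) * norm (\<i> * of_real b - r)) * ((l / b) ^ degree q * norm (poly q (\<i> * of_real b)))
      \<le> norm (\<i> * of_real l - r) * norm (poly q (\<i> * of_real l))"
    by (rule mult_mono[OF h2 h1]) (use l in simp_all)
  moreover have "norm (poly p z) = norm (z - r) * norm (poly q z)" for z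
    unfolding norm_mult[symmetric] q by (simp add: algebra_simps)
  ultimately show ?case by (simp add: dq mult_ac)
qed

text \<open>
  For \<open>z = x + i\<beta>\<close> with \<open>x\<close> real, \<open>c z + d\<close> is \<open>pencil c (c x + d) (i\<beta>)\<close>.
\<close>

definition pencil :: "real^'n^'n \<Rightarrow> real^'n^'n \<Rightarrow> complex \<Rightarrow> complex^'n^'n" where
  "pencil C D \<tau> = (\<chi> i j. of_real (D $ i $ j) + \<tau> * of_real (C $ i $ j))"

text \<open>With P = u D and Q = u C, the cross term in the squared norm of P + ib Q is 2b times the
  imaginary part of the Hermitian product of P and Q. Symmetry of D C^T makes that product
  real.\<close>

lemma sum_norm_row_pencil:
  fixes C D :: "real^'n^'n" and u :: "'n \<Rightarrow> complex"
  assumes sym: "D ** transpose C = C ** transpose D"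
  shows "(\<Sum>j\<in>UNIV. (norm (\<Sum>i\<in>UNIV. u i * pencil C D (\<i> * of_real b) $ i $ j))\<^sup>2)
       = (\<Sum>j\<in>UNIV. (norm (\<Sum>i\<in>UNIV. u i * of_real (D $ i $ j)))\<^sup>2)
         + b\<^sup>2 * (\<Sum>j\<in>UNIV. (norm (\<Sum>i\<in>UNIV. u i * of_real (C $ i $ j)))\<^sup>2)"
proof -
  define P where "P j = (\<Sum>i\<in>UNIV. u i * of_real (D $ i $ j))" for j
  define Q where "Q j = (\<Sum>i\<in>UNIV. u i * of_real (C $ i $ j))" for j
  define S where "S = (\<Sum>j\<in>UNIV. P j * cnj (Q j))"
  have K: "(\<Sum>j\<in>UNIV. D $ i $ j * C $ k $ j) = (\<Sum>j\<in>UNIV. D $ k $ j * C $ i $ j)" for i k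
    using sym by (simp add: vec_eq_iff matrix_matrix_mult_def transpose_def mult.commute)
  have "S = (\<Sum>j\<in>UNIV. \<Sum>i\<in>UNIV. \<Sum>k\<in>UNIV. u i * cnj (u k) * of_real (D $ i $ j * C $ k $ j))"
    by (simp add: S_def P_def Q_def sum_product mult_ac)
  also have "\<dots> = (\<Sum>i\<in>UNIV. \<Sum>k\<in>UNIV. \<Sum>j\<in>UNIV. u i * cnj (u k) * of_real (D $ i $ j * C $ k $ j))"
    by (subst sum.swap, rule sum.cong[OF refl], subst sum.swap, rule refl)
  also have "\<dots> = (\<Sum>i\<in>UNIV. \<Sum>k\<in>UNIV. u i * cnj (u k) * of_real (\<Sum>j\<in>UNIV. D $ i $ j * C $ k $ j))"
    by (simp add: sum_distrib_left)
  finally have S1: "S = (\<Sum>i\<in>UNIV. \<Sum>k\<in>UNIV. u i * cnj (u k) * of_real (\<Sum>j\<in>UNIV. D $ i $ j * C $ k $ j))" .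
  have "cnj S = (\<Sum>i\<in>UNIV. \<Sum>k\<in>UNIV. u k * cnj (u i) * of_real (\<Sum>j\<in>UNIV. D $ i $ j * C $ k $ j))"
    unfolding S1 by (simp add: mult_ac)
  also have "\<dots> = (\<Sum>k\<in>UNIV. \<Sum>i\<in>UNIV. u k * cnj (u i) * of_real (\<Sum>j\<in>UNIV. D $ i $ j * C $ k $ j))"
    by (rule sum.swap)
  also have "\<dots> = S"
    unfolding S1 by (intro sum.cong refl, subst K, rule refl)
  finally have "Im S = 0"
    by (metis Reals_cnj_iff complex_is_Real_iff)
  then have ImS: "(\<Sum>j\<in>UNIV. Im (P j) * Re (Q j) - Re (P j) * Im (Q j)) = 0"
    by (simp add: S_def)
  have "(norm (\<Sum>i\<in>UNIV. u i * pencil C D (\<i> * of_real b) $ i $ j))\<^sup>2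
      = (norm (P j))\<^sup>2 + b\<^sup>2 * (norm (Q j))\<^sup>2 + 2 * b * (Im (P j) * Re (Q j) - Re (P j) * Im (Q j))" for j
  proof -
    have "(\<Sum>i\<in>UNIV. u i * pencil C D (\<i> * of_real b) $ i $ j) = P j + \<i> * of_real b * Q j"
      by (simp add: pencil_def P_def Q_def sum.distrib sum_distrib_left algebra_simps)
    then show ?thesis
      by (simp only: cmod_power2) (simp add: power2_eq_square algebra_simps)
  qed
  then show ?thesis
    by (simp add: sum.distrib sum_distrib_left[symmetric] ImS P_def[symmetric] Q_def[symmetric])
qed

text \<open>A row u is recovered as (u C) X + (u D) Y, hence vanishes or stays bounded along with u
  C and u D.\<close>

lemma row_bezout:
  fixes C D X Y :: "real^'n^'n" and u :: "'n \<Rightarrow> complex"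
  assumes bez: "C ** X + D ** Y = mat 1"
  shows "u l = (\<Sum>k\<in>UNIV. (\<Sum>i\<in>UNIV. u i * of_real (C $ i $ k)) * of_real (X $ k $ l))
        + (\<Sum>k\<in>UNIV. (\<Sum>i\<in>UNIV. u i * of_real (D $ i $ k)) * of_real (Y $ k $ l))"
proof -
  have "u l = (\<Sum>i\<in>UNIV. u i * of_real ((C ** X + D ** Y) $ i $ l))"
    unfolding bez by (simp add: mat_def if_distrib[of "\<lambda>x. _ * of_real x"] cong: if_cong)
  also have "\<dots> = (\<Sum>i\<in>UNIV. \<Sum>k\<in>UNIV. u i * of_real (C $ i $ k) * of_real (X $ k $ l))
      + (\<Sum>i\<in>UNIV. \<Sum>k\<in>UNIV. u i * of_real (D $ i $ k) * of_real (Y $ k $ l))"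
    by (simp add: matrix_matrix_mult_def sum_distrib_left sum.distrib algebra_simps)
  also have "\<dots> = (\<Sum>k\<in>UNIV. (\<Sum>i\<in>UNIV. u i * of_real (C $ i $ k)) * of_real (X $ k $ l))
      + (\<Sum>k\<in>UNIV. (\<Sum>i\<in>UNIV. u i * of_real (D $ i $ k)) * of_real (Y $ k $ l))"
    unfolding sum_distrib_right by (intro arg_cong2[of _ _ _ _ "(+)"] sum.swap)
  finally show ?thesis .
qed

text \<open>A left null vector of the pencil makes both squares in the norm identity vanish, and the
  Bezout relation then makes the vector itself vanish. In polynomial terms: all roots of the
  determinant are real.\<close>

lemma det_pencil_nonzero:
  fixes C D X Y :: "real^'n^'n"
  assumes sym: "D ** transpose C = C ** transpose D" and bez: "C ** X + D ** Y = mat 1"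
    and \<tau>: "Im \<tau> \<noteq> 0"
  shows "det (pencil C D \<tau>) \<noteq> 0"
proof
  assume "det (pencil C D \<tau>) = 0"
  then have "det (transpose (pencil C D \<tau>)) = 0" by (simp add: det_transpose)
  then have "\<not> invertible (transpose (pencil C D \<tau>))" by (simp add: invertible_det_nz)
  then obtain u where u: "transpose (pencil C D \<tau>) *v u = 0" "u \<noteq> 0"
    by (metis invertible_left_inverse matrix_left_invertible_ker)
  \<comment> \<open>The norm identity concerns the imaginary axis, so the real part of the parameter
    is absorbed into \<open>D\<close>; this preserves the symmetry condition.\<close>
  define D' where "D' = D + Re \<tau> *\<^sub>R C"
  have sym': "D' ** transpose C = C ** transpose D'"
    using sym by (simp add: D'_def vec_eq_iff matrix_matrix_mult_def transpose_def algebra_simps sum.distrib)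
  have eq: "pencil C D \<tau> = pencil C D' (\<i> * of_real (Im \<tau>))"
    by (simp add: pencil_def D'_def vec_eq_iff complex_eq_iff)
  have "(\<Sum>i\<in>UNIV. u $ i * pencil C D \<tau> $ i $ j) = 0" for j
    using u(1) by (simp add: vec_eq_iff matrix_vector_mult_def transpose_def mult.commute)
  then have z: "(\<Sum>j\<in>UNIV. (norm (\<Sum>i\<in>UNIV. u $ i * of_real (D' $ i $ j)))\<^sup>2)
         + (Im \<tau>)\<^sup>2 * (\<Sum>j\<in>UNIV. (norm (\<Sum>i\<in>UNIV. u $ i * of_real (C $ i $ j)))\<^sup>2) = 0"
    using sum_norm_row_pencil[OF sym', of "\<lambda>i. u $ i" "Im \<tau>"] by (simp add: eq)
  have nn: "0 \<le> (\<Sum>j\<in>UNIV. (norm (\<Sum>i\<in>UNIV. u $ i * of_real (E $ i $ j)))\<^sup>2)" for E :: "real^'n^'n"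
    by (intro sum_nonneg) simp
  have "(\<Sum>j\<in>UNIV. (norm (\<Sum>i\<in>UNIV. u $ i * of_real (D' $ i $ j)))\<^sup>2) = 0 \<and>
      (Im \<tau>)\<^sup>2 * (\<Sum>j\<in>UNIV. (norm (\<Sum>i\<in>UNIV. u $ i * of_real (C $ i $ j)))\<^sup>2) = 0"
    using z by (subst (asm) add_nonneg_eq_0_iff) (intro nn mult_nonneg_nonneg zero_le_power2)+
  then have "(\<Sum>j\<in>UNIV. (norm (\<Sum>i\<in>UNIV. u $ i * of_real (C $ i $ j)))\<^sup>2) = 0"
       "(\<Sum>j\<in>UNIV. (norm (\<Sum>i\<in>UNIV. u $ i * of_real (D' $ i $ j)))\<^sup>2) = 0"
    using \<tau> by simp_all
  then have uC: "(\<Sum>i\<in>UNIV. u $ i * of_real (C $ i $ j)) = 0"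
    and uD': "(\<Sum>i\<in>UNIV. u $ i * of_real (D' $ i $ j)) = 0" for j
    by (simp_all add: sum_nonneg_eq_0_iff)
  have uD: "(\<Sum>i\<in>UNIV. u $ i * of_real (D $ i $ j)) = 0" for j
  proof -
    have "(\<Sum>i\<in>UNIV. u $ i * of_real (D' $ i $ j)) =
        (\<Sum>i\<in>UNIV. u $ i * of_real (D $ i $ j)) + Re \<tau> * (\<Sum>i\<in>UNIV. u $ i * of_real (C $ i $ j))"
      by (simp add: D'_def sum.distrib sum_distrib_left algebra_simps)
    then show ?thesis using uC uD' by simp
  qed
  have "u $ l = 0" for l
  proof -
    have "u $ l = (\<Sum>k\<in>UNIV. (\<Sum>i\<in>UNIV. u $ i * of_real (C $ i $ k)) * of_real (X $ k $ l))
        + (\<Sum>k\<in>UNIV. (\<Sum>i\<in>UNIV. u $ i * of_real (D $ i $ k)) * of_real (Y $ k $ l))"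
      by (rule row_bezout[OF bez])
    then show ?thesis by (simp add: uC uD)
  qed
  then show False using u(2) by (simp add: vec_eq_iff)
qed

text \<open>The rows of \<open>v ** pencil C D (i b) = mat 1\<close> are unit vectors, so for each
  row of v the norm identity reads 1 = |v D|^2 + b^2 |v C|^2.\<close>

lemma pencil_left_inverse_bounds:
  fixes C D :: "real^'n^'n"
  assumes sym: "D ** transpose C = C ** transpose D" and b: "b > 0"
    and v: "v ** pencil C D (\<i> * of_real b) = mat 1"
  shows "norm (\<Sum>k\<in>UNIV. v $ i $ k * of_real (C $ k $ j)) \<le> 1 / b"
    and "norm (\<Sum>k\<in>UNIV. v $ i $ k * of_real (D $ k $ j)) \<le> 1"
proof -
  let ?c = "\<lambda>j. (norm (\<Sum>k\<in>UNIV. v $ i $ k * of_real (C $ k $ j)))\<^sup>2"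
  let ?d = "\<lambda>j. (norm (\<Sum>k\<in>UNIV. v $ i $ k * of_real (D $ k $ j)))\<^sup>2"
  have "(\<Sum>k\<in>UNIV. v $ i $ k * pencil C D (\<i> * of_real b) $ k $ j) = (if i = j then 1 else 0)" for j
    using v by (simp add: vec_eq_iff matrix_matrix_mult_def mat_def)
  then have "(\<Sum>j\<in>UNIV. ?d j) + b\<^sup>2 * (\<Sum>j\<in>UNIV. ?c j) = (\<Sum>j\<in>UNIV. (norm (if i = j then 1 else 0 :: complex))\<^sup>2)"
    using sum_norm_row_pencil[OF sym, of "\<lambda>k. v $ i $ k" b] by simp
  also have "\<dots> = 1" by (simp add: if_distrib[of norm] if_distrib[of "\<lambda>x. x\<^sup>2"] cong: if_cong)
  finally have *: "(\<Sum>j\<in>UNIV. ?d j) + b\<^sup>2 * (\<Sum>j\<in>UNIV. ?c j) = 1" .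
  have "?d j \<le> (\<Sum>j\<in>UNIV. ?d j)" "?c j \<le> (\<Sum>j\<in>UNIV. ?c j)"
    by (rule member_le_sum; simp)+
  moreover have "0 \<le> (\<Sum>j\<in>UNIV. ?d j)" "0 \<le> (\<Sum>j\<in>UNIV. ?c j)" by (simp_all add: sum_nonneg)
  ultimately have "?d j \<le> 1\<^sup>2" "b\<^sup>2 * ?c j \<le> 1"
    using * mult_left_mono[of "?c j" "\<Sum>j\<in>UNIV. ?c j" "b\<^sup>2"] mult_nonneg_nonneg[of "b\<^sup>2" "\<Sum>j\<in>UNIV. ?c j"]
    by (simp_all del: mult_nonneg_nonneg)
  then have "norm (\<Sum>k\<in>UNIV. v $ i $ k * of_real (D $ k $ j)) \<le> 1"
    and "(b * norm (\<Sum>k\<in>UNIV. v $ i $ k * of_real (C $ k $ j)))\<^sup>2 \<le> 1\<^sup>2"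
    by (auto simp: power_mult_distrib abs_square_le_1)
  then show "norm (\<Sum>k\<in>UNIV. v $ i $ k * of_real (C $ k $ j)) \<le> 1 / b"
    and "norm (\<Sum>k\<in>UNIV. v $ i $ k * of_real (D $ k $ j)) \<le> 1"
    using b power2_le_imp_le[of "b * norm (\<Sum>k\<in>UNIV. v $ i $ k * of_real (C $ k $ j))" 1]
    by (auto simp: field_simps)
qed

section \<open>The determinant of a pencil as a polynomial\<close>

definition pencil_poly :: "real^'n^'n \<Rightarrow> real^'n^'n \<Rightarrow> complex poly" where
  "pencil_poly C D = det (\<chi> i j. [:of_real (D $ i $ j), of_real (C $ i $ j):])"

lemma poly_pencil_poly: "poly (pencil_poly C D) \<tau> = det (pencil C D \<tau>)"
  by (simp add: pencil_poly_def pencil_def det_def poly_sum poly_prod)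

lemma matrix_matrix_add_rdistrib:
  fixes A B :: "'a::semiring_1^'n^'m"
  shows "(A + B) ** C = A ** C + B ** C"
  by (simp add: matrix_matrix_mult_def vec_eq_iff distrib_right sum.distrib)

lemma matrix_matrix_diff_ldistrib:
  fixes A :: "'a::ring_1^'n^'m"
  shows "A ** (B - C) = A ** B - A ** C"
  by (simp add: matrix_matrix_mult_def vec_eq_iff right_diff_distrib sum_subtractf)

lemma coeff_prod_in_Ints:
  fixes f :: "'b \<Rightarrow> complex poly"
  assumes "\<And>i n. i \<in> A \<Longrightarrow> coeff (f i) n \<in> \<int>"
  shows "coeff (prod f A) n \<in> \<int>"
  using assms
proof (induction A arbitrary: n rule: infinite_finite_induct)
  case (insert a A)
  then show ?case by (auto simp: coeff_mult intro!: Ints_sum Ints_mult)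
qed (auto simp: coeff_1)

lemma coeff_pencil_poly_in_Ints:
  assumes "\<And>i j. C $ i $ j \<in> \<int>" "\<And>i j. D $ i $ j \<in> \<int>"
  shows "coeff (pencil_poly C D) n \<in> \<int>"
proof -
  have "complex_of_real x \<in> \<int>" if "x \<in> \<int>" for x
    using that by (auto elim!: Ints_cases)
  then have "coeff [:complex_of_real (D $ i $ j), complex_of_real (C $ i $ j):] m \<in> \<int>" for i j m
    using assms by (auto simp: coeff_pCons split: nat.split)
  then have "coeff (\<Prod>i\<in>UNIV. [:complex_of_real (D $ i $ p i), complex_of_real (C $ i $ p i):]) m \<in> \<int>" for p m
    by (intro coeff_prod_in_Ints) auto
  then show ?thesis
    unfolding pencil_poly_def det_def coeff_sum
    by (intro Ints_sum) (auto simp: sign_def)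
qed

text \<open>The inverse of the pencil stays bounded for \<open>b >= 1\<close> by
  \<open>row_bezout\<close>, so Cramer's rule bounds each entry of the pencil by a constant times
  its determinant; an entry with \<open>C $ i $ j\<close> nonzero has imaginary part growing
  linearly in b. This rules out a constant determinant polynomial.\<close>

lemma norm_det_pencil_unbounded:
  fixes C D X Y :: "real^'n^'n"
  assumes sym: "D ** transpose C = C ** transpose D" and bez: "C ** X + D ** Y = mat 1"
    and C: "C \<noteq> 0"
  obtains K where "\<And>b. b \<ge> 1 \<Longrightarrow> b \<le> K * norm (det (pencil C D (\<i> * of_real b)))"
proof -
  obtain i j where ij: "C $ i $ j \<noteq> 0" using C by (auto simp: vec_eq_iff)
  define R where "R = (\<Sum>k\<in>UNIV. \<Sum>l\<in>UNIV. \<bar>X $ k $ l\<bar> + \<bar>Y $ k $ l\<bar>)"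
  define L where "L = fact CARD('n) * (1 + R) ^ CARD('n)"
  have "b \<le> (L / \<bar>C $ i $ j\<bar>) * norm (det (pencil C D (\<i> * of_real b)))" if b: "b \<ge> 1" for b
  proof -
    let ?w = "pencil C D (\<i> * of_real b)"
    have "det ?w \<noteq> 0" using b by (intro det_pencil_nonzero[OF sym bez]) auto
    then obtain v where v: "v ** ?w = mat 1"
      by (metis invertible_det_nz invertible_left_inverse)
    have vR: "norm (v $ m $ l) \<le> R" for m l
    proof -
      have "norm (v $ m $ l) \<le> (\<Sum>k\<in>UNIV. norm ((\<Sum>i\<in>UNIV. v $ m $ i * of_real (C $ i $ k)) * of_real (X $ k $ l)))
          + (\<Sum>k\<in>UNIV. norm ((\<Sum>i\<in>UNIV. v $ m $ i * of_real (D $ i $ k)) * of_real (Y $ k $ l)))"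
        by (subst row_bezout[OF bez, of "\<lambda>l. v $ m $ l"])
           (rule norm_triangle_le[OF add_mono[OF norm_sum norm_sum]])
      also have "\<dots> \<le> (\<Sum>k\<in>UNIV. \<bar>X $ k $ l\<bar>) + (\<Sum>k\<in>UNIV. \<bar>Y $ k $ l\<bar>)"
      proof (intro add_mono sum_mono)
        fix k
        have "norm (\<Sum>i\<in>UNIV. v $ m $ i * of_real (C $ i $ k)) \<le> 1 / b"
          using b by (intro pencil_left_inverse_bounds(1)[OF sym _ v]) auto
        also have "\<dots> \<le> 1" using b by simp
        finally show "norm ((\<Sum>i\<in>UNIV. v $ m $ i * of_real (C $ i $ k)) * of_real (X $ k $ l)) \<le> \<bar>X $ k $ l\<bar>"
          by (simp add: norm_mult mult_left_le_one_le)
        have "norm (\<Sum>i\<in>UNIV. v $ m $ i * of_real (D $ i $ k)) \<le> 1"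
          using b by (intro pencil_left_inverse_bounds(2)[OF sym _ v]) auto
        then show "norm ((\<Sum>i\<in>UNIV. v $ m $ i * of_real (D $ i $ k)) * of_real (Y $ k $ l)) \<le> \<bar>Y $ k $ l\<bar>"
          by (simp add: norm_mult mult_left_le_one_le)
      qed
      also have "\<dots> = (\<Sum>k\<in>UNIV. \<bar>X $ k $ l\<bar> + \<bar>Y $ k $ l\<bar>)" by (simp add: sum.distrib)
      also have "\<dots> \<le> R"
        unfolding R_def by (intro sum_mono member_le_sum) auto
      finally show ?thesis .
    qed
    have "b * \<bar>C $ i $ j\<bar> \<le> norm (?w $ i $ j)"
      using b abs_Im_le_cmod[of "?w $ i $ j"] by (simp add: pencil_def abs_mult)
    also have "\<dots> \<le> norm (det ?w) * L"
      unfolding L_def by (rule norm_entry_le_det_mult[OF v vR])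
    finally show ?thesis using ij by (simp add: field_simps)
  qed
  then show thesis using that by blast
qed

lemma degree_pencil_poly_pos:
  fixes C D X Y :: "real^'n^'n"
  assumes "D ** transpose C = C ** transpose D" and "C ** X + D ** Y = mat 1" and "C \<noteq> 0"
  shows "degree (pencil_poly C D) > 0"
proof (rule ccontr)
  assume "\<not> ?thesis"
  then obtain a where a: "pencil_poly C D = [:a:]" using degree_eq_zeroE by blast
  obtain K where K: "\<And>b. b \<ge> 1 \<Longrightarrow> b \<le> K * norm (det (pencil C D (\<i> * of_real b)))"
    using norm_det_pencil_unbounded[OF assms] by blast
  have "b \<le> K * norm a" if "b \<ge> 1" for b
    using K[OF that] a by (simp flip: poly_pencil_poly)
  from this[of "\<bar>K * norm a\<bar> + 1"] show False by simp
qed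

text \<open>With w the pencil of C and D, the shifted pencil is w (1 + w^-1 C x), and the entries of
  w^-1 C are at most 1/b. The factor \<open>r b\<close> is the modulus of the determinant of the
  bracket.\<close>

lemma norm_det_pencil_shift_tendsto:
  fixes C D X Y x :: "real^'n^'n"
  assumes sym: "D ** transpose C = C ** transpose D" and bez: "C ** X + D ** Y = mat 1"
  obtains r where "(r \<longlongrightarrow> 1) at_top" and
    "\<And>b. b > 0 \<Longrightarrow> norm (det (pencil C (C ** x + D) (\<i> * of_real b)))
       = norm (det (pencil C D (\<i> * of_real b))) * r b"
proof -
  define v where "v b = (SOME v. v ** pencil C D (\<i> * of_real b) = mat 1)" for b
  have v: "v b ** pencil C D (\<i> * of_real b) = mat 1" if "b > 0" for b
  proof -
    have "det (pencil C D (\<i> * of_real b)) \<noteq> 0"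
      using that by (intro det_pencil_nonzero[OF sym bez]) auto
    then show ?thesis
      unfolding v_def by (metis (mono_tags, lifting) invertible_det_nz invertible_left_inverse someI_ex)
  qed
  define Q where "Q b = v b ** map_matrix complex_of_real C" for b
  define r where "r b = norm (det (mat 1 + Q b ** map_matrix of_real x))" for b
  have "((\<lambda>b. Q b $ i $ j) \<longlongrightarrow> 0) at_top" for i j
  proof (rule Lim_null_comparison)
    show "\<forall>\<^sub>F b in at_top. norm (Q b $ i $ j) \<le> 1 / b"
      using eventually_gt_at_top[of 0]
    proof eventually_elim
      case (elim b)
      then show ?case
        using pencil_left_inverse_bounds(1)[OF sym elim v[OF elim], of i j]
        by (simp add: Q_def matrix_matrix_mult_def)
    qed
    show "((\<lambda>b::real. 1 / b) \<longlongrightarrow> 0) at_top"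
      by (intro tendsto_divide_0[OF tendsto_const] filterlim_at_top_imp_at_infinity filterlim_ident)
  qed
  then have "((\<lambda>b. (mat 1 + Q b ** map_matrix of_real x) $ i $ j) \<longlongrightarrow>
      (mat 1 :: complex^'n^'n) $ i $ j + (\<Sum>k\<in>UNIV. 0 * of_real (x $ k $ j))) at_top" for i j
    by (simp only: vector_add_component matrix_matrix_mult_def vec_lambda_beta nth_map_matrix)
       (intro tendsto_intros)
  then have ent: "((\<lambda>b. (mat 1 + Q b ** map_matrix of_real x) $ i $ j) \<longlongrightarrow>
      (mat 1 :: complex^'n^'n) $ i $ j) at_top" for i j
    by simp
  have "((\<lambda>b. det (mat 1 + Q b ** map_matrix of_real x)) \<longlongrightarrow> det (mat 1 :: complex^'n^'n)) at_top"
    unfolding det_def by (intro tendsto_intros ent)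
  then have "(r \<longlongrightarrow> 1) at_top"
    unfolding r_def using tendsto_norm by fastforce
  moreover have "norm (det (pencil C (C ** x + D) (\<i> * of_real b)))
       = norm (det (pencil C D (\<i> * of_real b))) * r b" if b: "b > 0" for b
  proof -
    let ?w = "pencil C D (\<i> * of_real b)"
    have wv: "?w ** v b = mat 1" using v[OF b] matrix_left_right_inverse by blast
    have "?w ** (mat 1 + Q b ** map_matrix of_real x)
        = ?w + (?w ** v b) ** (map_matrix of_real C ** map_matrix of_real x)"
      by (simp add: Q_def matrix_add_ldistrib matrix_mul_assoc)
    also have "\<dots> = pencil C (C ** x + D) (\<i> * of_real b)"
      unfolding wv matrix_mul_lid by (simp add: pencil_def vec_eq_iff matrix_matrix_mult_def)
    finally show ?thesis
      unfolding r_def by (metis det_mul norm_mult)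
  qed
  ultimately show thesis using that by blast
qed

text \<open>
  The polynomial \<open>f\<^sub>x(\<tau>) = det (c (x + \<tau>) + d)\<close> has only real roots, whence
  \<open>\<bar>f\<^sub>x(il)\<bar> \<ge> (l/b)\<^sup>n \<bar>f\<^sub>x(ib)\<bar>\<close> for \<open>l \<le> b\<close>, with \<open>n\<close> its degree.  Letting \<open>b\<close> tend to infinity,
  \<open>f\<^sub>x\<close> may be replaced by \<open>f\<^sub>0\<close>, whose leading coefficient is a nonzero integer.
\<close>

lemma norm_det_pencil_ge:
  fixes C D X Y x :: "real^'n^'n"
  assumes sym: "D ** transpose C = C ** transpose D" and bez: "C ** X + D ** Y = mat 1"
    and C: "C \<noteq> 0" and int: "\<And>i j. C $ i $ j \<in> \<int>" "\<And>i j. D $ i $ j \<in> \<int>"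
    and x: "transpose x = x" and l: "l \<ge> 1"
  shows "l \<le> norm (det (pencil C (C ** x + D) (\<i> * of_real l)))"
proof -
  define D' where "D' = C ** x + D"
  have sym': "D' ** transpose C = C ** transpose D'"
  proof -
    have "C ** transpose (C ** x) = (C ** x) ** transpose C"
      by (simp add: matrix_transpose_mul x matrix_mul_assoc)
    moreover have "transpose D' = transpose (C ** x) + transpose D"
      by (simp add: D'_def transpose_def vec_eq_iff)
    ultimately show ?thesis
      by (simp add: D'_def matrix_add_ldistrib matrix_matrix_add_rdistrib sym)
  qed
  \<comment> \<open>Substituting \<open>D = D' - C ** x\<close> into the Bezout relation produces
    the correction \<open>- x ** Y\<close>.\<close>
  have bez': "C ** (X - x ** Y) + D' ** Y = mat 1"
    unfolding bez[symmetric] D'_def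
    by (simp add: matrix_matrix_diff_ldistrib matrix_matrix_add_rdistrib matrix_mul_assoc)
  define p0 where "p0 = pencil_poly C D"
  define p where "p = pencil_poly C D'"
  obtain r where r1: "(r \<longlongrightarrow> 1) at_top" and
    r: "\<And>b. b > 0 \<Longrightarrow> norm (poly p (\<i> * of_real b)) = norm (poly p0 (\<i> * of_real b)) * r b"
    using norm_det_pencil_shift_tendsto[OF sym bez, of x thesis]
    by (simp add: p_def p0_def D'_def poly_pencil_poly)
  have deg0: "degree p0 > 0"
    unfolding p0_def by (rule degree_pencil_poly_pos[OF sym bez C])
  have p: "p \<noteq> 0"
    using det_pencil_nonzero[OF sym' bez', of \<i>] by (auto simp: p_def simp flip: poly_pencil_poly)
  have roots: "Im z = 0" if "poly p z = 0" for z
    using det_pencil_nonzero[OF sym' bez', of z] that by (auto simp: p_def poly_pencil_poly)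
  have lim0: "((\<lambda>b. norm (poly p0 (\<i> * of_real b)) / b ^ degree p0) \<longlongrightarrow> norm (lead_coeff p0)) at_top"
    by (rule norm_poly_imaginary_axis_tendsto)
  have lim: "((\<lambda>b. norm (poly p0 (\<i> * of_real b)) / b ^ degree p0 * r b) \<longlongrightarrow> norm (lead_coeff p0)) at_top"
    using tendsto_mult[OF lim0 r1] by simp
  \<comment> \<open>This one inequality suffices, since \<open>l / b <= 1\<close> makes its powers
    decrease in the exponent. A larger degree would force the leading coefficient of
    \<open>p\<close> to vanish.\<close>
  have deg: "degree p \<le> degree p0"
  proof (rule ccontr)
    assume "\<not> ?thesis"
    then obtain m where m: "degree p = degree p0 + Suc m"
      by (metis add_Suc_right less_imp_Suc_add not_le_imp_less)
    have "((\<lambda>b. inverse (b ^ Suc m)) \<longlongrightarrow> (0::real)) at_top"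
      by (intro tendsto_inverse_0_at_top filterlim_pow_at_top filterlim_ident) auto
    from tendsto_mult[OF lim this]
    have "((\<lambda>b. norm (poly p0 (\<i> * of_real b)) / b ^ degree p0 * r b * inverse (b ^ Suc m)) \<longlongrightarrow> 0) at_top"
      by simp
    moreover have "\<forall>\<^sub>F b in at_top. norm (poly p0 (\<i> * of_real b)) / b ^ degree p0 * r b * inverse (b ^ Suc m)
        = norm (poly p (\<i> * of_real b)) / b ^ degree p"
      using eventually_gt_at_top[of 0]
      by eventually_elim (simp add: r m power_add divide_inverse mult_ac)
    ultimately have "((\<lambda>b. norm (poly p (\<i> * of_real b)) / b ^ degree p) \<longlongrightarrow> 0) at_top"
      by (simp add: tendsto_cong)
    then have "norm (lead_coeff p) = 0"
      using norm_poly_imaginary_axis_tendsto tendsto_unique trivial_limit_at_top_linorder by blast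
    then show False using p by simp
  qed
  \<comment> \<open>The coefficients of \<open>p\<close> need not be integers because
    \<open>x\<close> is real, so integrality is read off \<open>p0\<close>; its positive degree
    makes the leading coefficient nonzero.\<close>
  have "lead_coeff p0 \<in> \<int>" "lead_coeff p0 \<noteq> 0"
    using coeff_pencil_poly_in_Ints[OF int] deg0 by (auto simp: p0_def)
  then have lc: "1 \<le> norm (lead_coeff p0)"
    by (auto elim!: Ints_cases simp del: leading_coeff_0_iff)
  have "l ^ degree p0 * norm (lead_coeff p0) \<le> norm (poly p (\<i> * of_real l))"
  proof (rule tendsto_upperbound)
    show "((\<lambda>b. l ^ degree p0 * (norm (poly p0 (\<i> * of_real b)) / b ^ degree p0 * r b))
        \<longlongrightarrow> l ^ degree p0 * norm (lead_coeff p0)) at_top"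
      by (intro tendsto_mult lim tendsto_const)
    show "\<forall>\<^sub>F b in at_top. l ^ degree p0 * (norm (poly p0 (\<i> * of_real b)) / b ^ degree p0 * r b)
        \<le> norm (poly p (\<i> * of_real l))"
      using eventually_ge_at_top[of l]
    proof eventually_elim
      case (elim b)
      have "l ^ degree p0 * (norm (poly p0 (\<i> * of_real b)) / b ^ degree p0 * r b)
          = (l / b) ^ degree p0 * norm (poly p (\<i> * of_real b))"
        using elim l by (simp add: r power_divide)
      also have "\<dots> \<le> (l / b) ^ degree p * norm (poly p (\<i> * of_real b))"
        using elim l by (intro mult_right_mono power_decreasing deg) auto
      also have "\<dots> \<le> norm (poly p (\<i> * of_real l))"
        using elim l by (intro norm_poly_real_roots_growth roots) auto
      finally show ?case .
    qed
  qed auto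
  moreover have "l ^ 1 * 1 \<le> l ^ degree p0 * norm (lead_coeff p0)"
    using l deg0 lc by (intro mult_mono power_increasing) auto
  ultimately show ?thesis
    by (simp add: p_def D'_def poly_pencil_poly)
qed

section \<open>The integral symplectic group and its cosets\<close>

lemma map_matrix_of_int_mult:
  "map_matrix (of_int :: int \<Rightarrow> 'a::ring_1) (A ** B) = map_matrix of_int A ** map_matrix of_int B"
  by (simp add: matrix_matrix_mult_def vec_eq_iff)

lemma map_matrix_of_int_mat_1: "map_matrix (of_int :: int \<Rightarrow> 'a::ring_1) (mat 1) = mat 1"
  by (simp add: mat_def vec_eq_iff)

lemma int_matrix_left_right_inverse:
  fixes A B :: "int^'n^'n"
  assumes "A ** B = mat 1"
  shows "B ** A = mat 1"
proof -
  have "map_matrix (of_int :: int \<Rightarrow> real) A ** map_matrix of_int B = mat 1"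
    by (metis assms map_matrix_of_int_mult map_matrix_of_int_mat_1)
  then have "map_matrix (of_int :: int \<Rightarrow> real) B ** map_matrix of_int A = mat 1"
    using matrix_left_right_inverse by blast
  then have "map_matrix (of_int :: int \<Rightarrow> real) (B ** A) = map_matrix of_int (mat 1)"
    by (simp add: map_matrix_of_int_mult map_matrix_of_int_mat_1)
  then show ?thesis by (simp add: vec_eq_iff)
qed

lemma matrix_mult_minus_left:
  fixes A :: "'a::ring_1^'n^'m"
  shows "(- A) ** B = - (A ** B)"
  by (simp add: matrix_matrix_mult_def vec_eq_iff sum_negf)

lemma matrix_mult_minus_right:
  fixes A :: "'a::ring_1^'n^'m"
  shows "A ** (- B) = - (A ** B)"
  by (simp add: matrix_matrix_mult_def vec_eq_iff sum_negf)

lemma transpose_uminus: "transpose (- A) = - transpose A"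
  by (simp add: transpose_def vec_eq_iff)

lemma transpose_diff: "transpose (A - B) = transpose A - transpose B"
  by (simp add: transpose_def vec_eq_iff)

lemma transpose_0: "transpose 0 = 0"
  by (simp add: transpose_def vec_eq_iff)

lemma block_matrix_blocks: "block_matrix (block_a M) (block_b M) (block_c M) (block_d M) = M"
  by (auto simp: block_matrix_def block_a_def block_b_def block_c_def block_d_def vec_eq_iff
      split: sum.splits)

lemma blocks_block_matrix [simp]:
  "block_a (block_matrix a b c d) = a" "block_b (block_matrix a b c d) = b"
  "block_c (block_matrix a b c d) = c" "block_d (block_matrix a b c d) = d"
  by (auto simp: block_matrix_def block_a_def block_b_def block_c_def block_d_def vec_eq_iff)

lemma block_matrix_eq_iff:
  "block_matrix a b c d = block_matrix a' b' c' d' \<longleftrightarrow> a = a' \<and> b = b' \<and> c = c' \<and> d = d'"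
  by (metis blocks_block_matrix)

lemma block_matrix_mult:
  fixes a b c d :: "'a::semiring_1^'n^'n"
  shows "block_matrix a b c d ** block_matrix a' b' c' d' =
     block_matrix (a ** a' + b ** c') (a ** b' + b ** d') (c ** a' + d ** c') (c ** b' + d ** d')"
proof -
  have sum: "(\<Sum>k\<in>(UNIV :: ('n + 'n) set). f k) = (\<Sum>k\<in>UNIV. f (Inl k)) + (\<Sum>k\<in>UNIV. f (Inr k))"
    for f :: "'n::finite + 'n \<Rightarrow> 'a"
    by (subst UNIV_Plus_UNIV[symmetric], subst sum.Plus) (simp_all add: o_def)
  have "(block_matrix a b c d ** block_matrix a' b' c' d') $ i $ j =
     block_matrix (a ** a' + b ** c') (a ** b' + b ** d') (c ** a' + d ** c') (c ** b' + d ** d') $ i $ j" for i j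
    by (cases i; cases j) (simp_all add: block_matrix_def matrix_matrix_mult_def sum)
  then show ?thesis by (simp add: vec_eq_iff)
qed

lemma transpose_block_matrix:
  "transpose (block_matrix a b c d) = block_matrix (transpose a) (transpose c) (transpose b) (transpose d)"
  by (auto simp: block_matrix_def vec_eq_iff transpose_def split: sum.splits)

lemma mat_1_block_matrix: "mat 1 = block_matrix (mat 1) 0 0 (mat 1)"
  by (auto simp: block_matrix_def vec_eq_iff mat_def split: sum.splits)

lemma Sp_int_block_matrix_iff:
  "block_matrix a b c d \<in> Sp_int \<longleftrightarrow>
     transpose a ** c = transpose c ** a \<and> transpose b ** d = transpose d ** b \<and>
     transpose a ** d - transpose c ** b = mat 1"
proof -
  have "transpose (transpose a ** d - transpose c ** b) = transpose d ** a - transpose b ** c"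
    by (simp add: transpose_diff matrix_transpose_mul)
  then have *: "transpose d ** a - transpose b ** c = mat 1"
    if "transpose a ** d - transpose c ** b = mat 1"
    using that by (simp add: transpose_mat)
  show ?thesis
    unfolding Sp_int_def mem_Collect_eq transpose_block_matrix block_matrix_mult block_matrix_eq_iff
    using * by (auto simp: matrix_mult_minus_left matrix_mult_minus_right algebra_simps)
qed

lemma Sp_int_left_equations:
  assumes "M \<in> Sp_int"
  shows "transpose (block_a M) ** block_c M = transpose (block_c M) ** block_a M"
    and "transpose (block_b M) ** block_d M = transpose (block_d M) ** block_b M"
    and "transpose (block_a M) ** block_d M - transpose (block_c M) ** block_b M = mat 1"
  using assms Sp_int_block_matrix_iff[of "block_a M" "block_b M" "block_c M" "block_d M"]
  by (auto simp: block_matrix_blocks)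

text \<open>This is J^-1 M^T J for the standard symplectic matrix J, so the defining relation of the
  group says that it is a left inverse.\<close>

definition Sp_inverse :: "int^('n::finite + 'n)^('n + 'n) \<Rightarrow> int^('n + 'n)^('n + 'n)" where
  "Sp_inverse M = block_matrix (transpose (block_d M)) (- transpose (block_b M))
                               (- transpose (block_c M)) (transpose (block_a M))"

lemma Sp_inverse_mult:
  assumes "M \<in> Sp_int"
  shows "Sp_inverse M ** M = mat 1" "M ** Sp_inverse M = mat 1"
proof -
  note eqs = Sp_int_left_equations[OF assms]
  have "transpose (transpose (block_a M) ** block_d M - transpose (block_c M) ** block_b M) = mat 1"
    by (simp add: eqs transpose_mat)
  then have "transpose (block_d M) ** block_a M - transpose (block_b M) ** block_c M = mat 1"
    by (simp add: transpose_diff matrix_transpose_mul)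
  then have "Sp_inverse M ** block_matrix (block_a M) (block_b M) (block_c M) (block_d M) = mat 1"
    unfolding Sp_inverse_def block_matrix_mult mat_1_block_matrix block_matrix_eq_iff
    using eqs by (simp add: matrix_mult_minus_left algebra_simps)
  then show "Sp_inverse M ** M = mat 1" by (simp add: block_matrix_blocks)
  then show "M ** Sp_inverse M = mat 1" by (rule int_matrix_left_right_inverse)
qed

text \<open>Relations between rows instead of columns, read off
  \<open>M ** Sp_inverse M = mat 1\<close>. Those for the lower row are the symmetry and Bezout
  conditions of the pencil lemmas.\<close>

lemma Sp_int_right_equations:
  assumes "M \<in> Sp_int"
  shows "block_a M ** transpose (block_b M) = block_b M ** transpose (block_a M)"
    and "block_c M ** transpose (block_d M) = block_d M ** transpose (block_c M)"
    and "block_a M ** transpose (block_d M) - block_b M ** transpose (block_c M) = mat 1"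
    and "block_d M ** transpose (block_a M) - block_c M ** transpose (block_b M) = mat 1"
proof -
  have "block_matrix (block_a M) (block_b M) (block_c M) (block_d M) ** Sp_inverse M = mat 1"
    using Sp_inverse_mult(2)[OF assms] by (simp add: block_matrix_blocks)
  then show "block_a M ** transpose (block_b M) = block_b M ** transpose (block_a M)"
    and "block_c M ** transpose (block_d M) = block_d M ** transpose (block_c M)"
    and "block_a M ** transpose (block_d M) - block_b M ** transpose (block_c M) = mat 1"
    and "block_d M ** transpose (block_a M) - block_c M ** transpose (block_b M) = mat 1"
    unfolding Sp_inverse_def block_matrix_mult mat_1_block_matrix block_matrix_eq_iff
    by (simp_all add: matrix_mult_minus_right algebra_simps)
qed

lemma Sp_int_mult_Sp_inverse:
  fixes M N :: "int^('n::finite + 'n)^('n + 'n)"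
  assumes M: "M \<in> Sp_int" and N: "N \<in> Sp_int"
  shows "N ** Sp_inverse M \<in> Sp_int"
proof -
  let ?J = "block_matrix 0 (mat 1) (- mat 1) 0 :: int^('n + 'n)^('n + 'n)"
  let ?L = "Sp_inverse M"
  have J: "transpose M ** ?J ** M = ?J" "transpose N ** ?J ** N = ?J"
    using assms by (simp_all add: Sp_int_def)
  have "transpose (N ** ?L) ** ?J ** (N ** ?L) = transpose ?L ** (transpose N ** ?J ** N) ** ?L"
    by (simp add: matrix_transpose_mul matrix_mul_assoc)
  also have "\<dots> = transpose ?L ** (transpose M ** ?J ** M) ** ?L"
    by (simp only: J)
  also have "\<dots> = transpose (M ** ?L) ** ?J ** (M ** ?L)"
    by (simp add: matrix_transpose_mul matrix_mul_assoc)
  also have "\<dots> = ?J"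
    by (simp add: Sp_inverse_mult(2)[OF M] transpose_mat)
  finally show ?thesis by (simp add: Sp_int_def)
qed

lemma uminus_Sp_int: "M \<in> Sp_int \<Longrightarrow> - M \<in> Sp_int"
  by (simp add: Sp_int_def transpose_uminus matrix_mult_minus_left matrix_mult_minus_right)

lemma blocks_uminus:
  "block_a (- M) = - block_a M" "block_b (- M) = - block_b M"
  "block_c (- M) = - block_c M" "block_d (- M) = - block_d M"
  by (auto simp: block_a_def block_b_def block_c_def block_d_def vec_eq_iff)

section \<open>Cosets and the pair of lower blocks\<close>

lemma same_lower_blocks:
  assumes M: "M \<in> Sp_int" and N: "N \<in> Sp_int"
    and "block_c N = block_c M" "block_d N = block_d M"
  obtains S where "transpose S = S" "N = block_matrix (mat 1) S 0 (mat 1) ** M"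
proof -
  \<comment> \<open>\<open>S\<close> is the upper right block of N M^-1. The other blocks collapse
    to 1, 0, 1 because the lower rows agree, and \<open>S\<close> is symmetric because N M^-1 is
    symplectic.\<close>
  define S where "S = block_b N ** transpose (block_a M) - block_a N ** transpose (block_b M)"
  have "block_matrix (block_a N) (block_b N) (block_c N) (block_d N) ** Sp_inverse M
      = block_matrix (mat 1) S 0 (mat 1)"
    unfolding Sp_inverse_def block_matrix_mult block_matrix_eq_iff S_def
    using Sp_int_right_equations[OF M] Sp_int_right_equations[OF N] assms(3-)
    by (simp add: matrix_mult_minus_right algebra_simps)
  then have P: "N ** Sp_inverse M = block_matrix (mat 1) S 0 (mat 1)"
    by (simp add: block_matrix_blocks)
  then have "block_matrix (mat 1) S 0 (mat 1) \<in> Sp_int"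
    using Sp_int_mult_Sp_inverse[OF M N] by simp
  then have "transpose S = S"
    by (simp add: Sp_int_block_matrix_iff transpose_mat)
  moreover have "N = N ** (Sp_inverse M ** M)"
    by (simp add: Sp_inverse_mult(1)[OF M])
  then have "N = block_matrix (mat 1) S 0 (mat 1) ** M"
    by (simp only: matrix_mul_assoc P)
  ultimately show thesis using that by blast
qed

lemma lower_blocks_unipotent_mult:
  "block_c (block_matrix (mat 1) S 0 (mat 1) ** M) = block_c M"
  "block_d (block_matrix (mat 1) S 0 (mat 1) ** M) = block_d M"
  by (subst block_matrix_blocks[of M, symmetric], simp add: block_matrix_mult)+

text \<open>A coset is its lower row (c, d) up to a common sign; this is what turns sums over cosets
  into sums over pairs of integer matrices.\<close>

lemma left_coset_rel_iff:
  assumes M: "M \<in> Sp_int" and N: "N \<in> Sp_int"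
  shows "(M, N) \<in> left_coset_rel \<longleftrightarrow>
    block_c N = block_c M \<and> block_d N = block_d M \<or>
    block_c N = - block_c M \<and> block_d N = - block_d M"
proof
  assume "(M, N) \<in> left_coset_rel"
  then obtain u where u: "u \<in> Gamma_infinity" "N = u ** M" by (auto simp: left_coset_rel_def)
  then consider S where "u = block_matrix (mat 1) S 0 (mat 1)" | S where "u = - block_matrix (mat 1) S 0 (mat 1)"
    by (auto simp: Gamma_infinity_def)
  then show "block_c N = block_c M \<and> block_d N = block_d M \<or>
    block_c N = - block_c M \<and> block_d N = - block_d M"
    using u(2) by cases
      (simp_all add: lower_blocks_unipotent_mult matrix_mult_minus_left blocks_uminus)
next
  assume "block_c N = block_c M \<and> block_d N = block_d M \<or>
    block_c N = - block_c M \<and> block_d N = - block_d M"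
  then show "(M, N) \<in> left_coset_rel"
  proof
    assume "block_c N = block_c M \<and> block_d N = block_d M"
    then obtain S where "transpose S = S" "N = block_matrix (mat 1) S 0 (mat 1) ** M"
      using same_lower_blocks[OF M N] by blast
    then show ?thesis using M N by (auto simp: left_coset_rel_def Gamma_infinity_def)
  next
    assume "block_c N = - block_c M \<and> block_d N = - block_d M"
    then have "block_c (- N) = block_c M" "block_d (- N) = block_d M"
      by (simp_all add: blocks_uminus)
    then obtain S where S: "transpose S = S" "- N = block_matrix (mat 1) S 0 (mat 1) ** M"
      using same_lower_blocks[OF M uminus_Sp_int[OF N]] by blast
    then have "N = - block_matrix (mat 1) S 0 (mat 1) ** M"
      by (metis matrix_mult_minus_left minus_minus)
    then show ?thesis using S(1) M N by (auto simp: left_coset_rel_def Gamma_infinity_def)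
  qed
qed

lemma equiv_left_coset_rel:
  "equiv (Sp_int :: (int^('n::finite + 'n)^('n + 'n)) set) left_coset_rel"
  (is "equiv ?S ?R")
proof (rule equivI)
  show "?R \<subseteq> ?S \<times> ?S" by (auto simp: left_coset_rel_def)
  show "refl_on ?S ?R"
    by (rule refl_onI) (auto simp: left_coset_rel_iff)
  show "sym ?R"
  proof (rule symI)
    fix M N :: "int^('n + 'n)^('n + 'n)" assume *: "(M, N) \<in> left_coset_rel"
    then have "M \<in> Sp_int" "N \<in> Sp_int" by (auto simp: left_coset_rel_def)
    then show "(N, M) \<in> left_coset_rel" using * by (auto simp: left_coset_rel_iff)
  qed
  show "trans ?R"
  proof (rule transI)
    fix M N P :: "int^('n + 'n)^('n + 'n)" assume *: "(M, N) \<in> left_coset_rel" "(N, P) \<in> left_coset_rel"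
    then have "M \<in> Sp_int" "N \<in> Sp_int" "P \<in> Sp_int" by (auto simp: left_coset_rel_def)
    then show "(M, P) \<in> left_coset_rel" using * by (auto simp: left_coset_rel_iff)
  qed
qed

definition coset_rep :: "(int^('n::finite + 'n)^('n + 'n)) set \<Rightarrow> int^('n + 'n)^('n + 'n)" where
  "coset_rep C = (SOME M. M \<in> C)"

lemma coset_rep_in:
  assumes "C \<in> Sp_int // left_coset_rel"
  shows "coset_rep C \<in> C" "coset_rep C \<in> Sp_int"
proof -
  show "coset_rep C \<in> C"
    unfolding coset_rep_def
    using in_quotient_imp_non_empty[OF equiv_left_coset_rel assms] by (simp add: some_in_eq)
  then show "coset_rep C \<in> Sp_int"
    using in_quotient_imp_subset[OF equiv_left_coset_rel assms] by blast
qed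

lemma coset_rep_eqI:
  assumes "C \<in> Sp_int // left_coset_rel" "C' \<in> Sp_int // left_coset_rel"
    and "block_c (coset_rep C') = block_c (coset_rep C) \<and> block_d (coset_rep C') = block_d (coset_rep C) \<or>
         block_c (coset_rep C') = - block_c (coset_rep C) \<and> block_d (coset_rep C') = - block_d (coset_rep C)"
  shows "C = C'"
proof -
  have "(coset_rep C, coset_rep C') \<in> left_coset_rel"
    using assms coset_rep_in by (subst left_coset_rel_iff) auto
  then show ?thesis
    using assms coset_rep_in quotient_eq_iff[OF equiv_left_coset_rel] by blast
qed

lemma coset_rep_exists:
  assumes M: "M \<in> Sp_int"
  obtains C where "C \<in> Sp_int // left_coset_rel"
    "block_c (coset_rep C) = block_c M \<and> block_d (coset_rep C) = block_d M \<or>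
     block_c (coset_rep C) = - block_c M \<and> block_d (coset_rep C) = - block_d M"
proof -
  define C where "C = left_coset_rel `` {M}"
  have C: "C \<in> Sp_int // left_coset_rel" unfolding C_def using M by (rule quotientI)
  then have "(M, coset_rep C) \<in> left_coset_rel"
    using coset_rep_in(1) by (auto simp: C_def)
  then show thesis
    using that[OF C] left_coset_rel_iff[OF M coset_rep_in(2)[OF C]] by blast
qed

section \<open>Cosets with c = 0 and GL(g, Z)\<close>

definition parabolic_cosets :: "(int^('n::finite + 'n)^('n + 'n)) set set" where
  "parabolic_cosets = {C \<in> Sp_int // left_coset_rel. block_c (coset_rep C) = 0}"

lemma parabolic_inverse:
  assumes "M \<in> Sp_int" "block_c M = 0"
  shows "transpose (block_a M) ** block_d M = mat 1" "block_d M ** transpose (block_a M) = mat 1"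
    "block_a M ** transpose (block_d M) = mat 1" "transpose (block_d M) ** block_a M = mat 1"
proof -
  show "transpose (block_a M) ** block_d M = mat 1"
    using Sp_int_left_equations(3)[OF assms(1)] by (simp add: assms(2) transpose_0)
  show "block_a M ** transpose (block_d M) = mat 1"
    using Sp_int_right_equations(3)[OF assms(1)] by (simp add: assms(2) transpose_0)
  then show "transpose (block_d M) ** block_a M = mat 1" by (rule int_matrix_left_right_inverse)
  show "block_d M ** transpose (block_a M) = mat 1"
    using Sp_int_right_equations(4)[OF assms(1)] by (simp add: assms(2))
qed

text \<open>For c = 0 the block d is the inverse transpose of a, so a up to sign determines the
  lower row up to sign.\<close>

lemma parabolic_coset_eqI:
  assumes C: "C \<in> parabolic_cosets" and C': "C' \<in> parabolic_cosets"
    and eq: "block_a (coset_rep C') = block_a (coset_rep C) \<or>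
      block_a (coset_rep C') = - block_a (coset_rep C)"
  shows "C = C'"
proof -
  let ?M = "coset_rep C" and ?N = "coset_rep C'"
  have MN: "?M \<in> Sp_int" "?N \<in> Sp_int" "block_c ?M = 0" "block_c ?N = 0"
    using C C' coset_rep_in(2) by (auto simp: parabolic_cosets_def)
  have "block_d ?N = block_d ?M ** (transpose (block_a ?M) ** block_d ?N)"
    by (simp add: matrix_mul_assoc parabolic_inverse(2)[OF MN(1,3)])
  moreover have "transpose (block_a ?M) ** block_d ?N = mat 1 \<or> transpose (block_a ?M) ** block_d ?N = - mat 1"
    using eq parabolic_inverse(1)[OF MN(2,4)]
    by (auto simp: transpose_uminus matrix_mult_minus_left neg_eq_iff_add_eq_0 equation_minus_iff)
  ultimately have "block_d ?N = block_d ?M \<or> block_d ?N = - block_d ?M"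
    by (auto simp: matrix_mult_minus_right)
  then show ?thesis
    using C C' MN by (intro coset_rep_eqI) (auto simp: parabolic_cosets_def)
qed

lemma inj_on_parabolic_block_a: "inj_on (\<lambda>C. block_a (coset_rep C)) parabolic_cosets"
  by (rule inj_onI) (metis parabolic_coset_eqI)

text \<open>Together with \<open>inj_on_parabolic_block_a\<close> and
  \<open>parabolic_block_a_disjoint\<close> this exhibits GL(g, Z) as two disjoint copies of the set
  of cosets with c = 0, which is the source of the factor 1/2.\<close>

lemma GL_int_eq:
  "{a :: int^'n^'n. invertible a} =
     (\<lambda>C. block_a (coset_rep C)) ` parabolic_cosets \<union> (\<lambda>C. - block_a (coset_rep C)) ` parabolic_cosets"
proof (intro equalityI subsetI)
  fix a :: "int^'n^'n" assume "a \<in> {a. invertible a}"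
  then obtain a' where a': "a ** a' = mat 1" "a' ** a = mat 1" by (auto simp: invertible_def)
  \<comment> \<open>The block diagonal matrix of \<open>a\<close> and its inverse transpose. The
    representative of its coset may differ from it by a sign, whence the two cases below.\<close>
  define M where "M = block_matrix a 0 0 (transpose a')"
  have "transpose a ** transpose a' = mat 1"
    by (metis a'(2) matrix_transpose_mul transpose_mat)
  then have "M \<in> Sp_int"
    by (simp add: M_def Sp_int_block_matrix_iff transpose_0)
  then obtain C where C: "C \<in> Sp_int // left_coset_rel"
    "block_c (coset_rep C) = 0" "block_d (coset_rep C) = transpose a' \<or> block_d (coset_rep C) = - transpose a'"
    by (rule coset_rep_exists) (auto simp: M_def)
  let ?a = "block_a (coset_rep C)"
  have inv: "?a ** transpose (block_d (coset_rep C)) = mat 1"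
    using parabolic_inverse(3) coset_rep_in(2) C by blast
  have "?a = (?a ** a') ** a"
    by (simp add: matrix_mul_assoc[symmetric] a')
  moreover have "?a ** a' = mat 1 \<or> ?a ** a' = - mat 1"
  proof -
    have "transpose (block_d (coset_rep C)) = a' \<or> transpose (block_d (coset_rep C)) = - a'"
      using C(3) by (metis transpose_transpose transpose_uminus)
    then show ?thesis using inv by (auto simp: matrix_mult_minus_right equation_minus_iff)
  qed
  ultimately have "?a = a \<or> - ?a = a"
    by (auto simp: matrix_mult_minus_left)
  moreover have "C \<in> parabolic_cosets" using C by (simp add: parabolic_cosets_def)
  ultimately show "a \<in> (\<lambda>C. block_a (coset_rep C)) ` parabolic_cosets \<union>
      (\<lambda>C. - block_a (coset_rep C)) ` parabolic_cosets"
    by blast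
next
  fix a :: "int^'n^'n"
  assume "a \<in> (\<lambda>C. block_a (coset_rep C)) ` parabolic_cosets \<union>
      (\<lambda>C. - block_a (coset_rep C)) ` parabolic_cosets"
  then obtain C where C: "C \<in> parabolic_cosets"
    "a = block_a (coset_rep C) \<or> a = - block_a (coset_rep C)" by blast
  then have M: "coset_rep C \<in> Sp_int" "block_c (coset_rep C) = 0"
    using coset_rep_in(2) by (auto simp: parabolic_cosets_def)
  let ?d = "transpose (block_d (coset_rep C))"
  have "a ** ?d = mat 1 \<and> ?d ** a = mat 1 \<or> a ** (- ?d) = mat 1 \<and> (- ?d) ** a = mat 1"
    using C(2) parabolic_inverse(3,4)[OF M]
    by (auto simp: matrix_mult_minus_left matrix_mult_minus_right)
  then show "a \<in> {a. invertible a}" by (auto simp: invertible_def)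
qed

lemma parabolic_block_a_disjoint:
  "(\<lambda>C. block_a (coset_rep C)) ` parabolic_cosets \<inter>
     (\<lambda>C. - block_a (coset_rep C) :: int^'n^'n) ` parabolic_cosets = {}"
proof -
  have False if C: "C \<in> parabolic_cosets" "C' \<in> parabolic_cosets"
    and eq: "block_a (coset_rep C) = (- block_a (coset_rep C') :: int^'n^'n)" for C C'
  proof -
    have "C = C'" using C eq by (intro parabolic_coset_eqI) auto
    then have "block_a (coset_rep C) = 0"
      using eq by (simp add: vec_eq_iff)
    moreover have "block_a (coset_rep C) ** transpose (block_d (coset_rep C)) = mat 1"
      using C(1) coset_rep_in(2) by (intro parabolic_inverse(3)) (auto simp: parabolic_cosets_def)
    ultimately have "mat 1 = (0 :: int^'n^'n)" by simp
    then have "(mat 1 :: int^'n^'n) $ undefined $ undefined = 0" by (simp only: zero_index)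
    then show False by (simp add: mat_def)
  qed
  then show ?thesis by blast
qed

section \<open>The points x + il and the action on them\<close>

definition half_space_point :: "real \<Rightarrow> real^'n^'n \<Rightarrow> complex^'n^'n" where
  "half_space_point l x = (\<chi> i j. Complex (x $ i $ j) (if i = j then l else 0))"

lemma half_space_point_in:
  fixes x :: "real^'n^'n"
  assumes "transpose x = x" "l > 0"
  shows "half_space_point l x \<in> siegel_half_space"
proof -
  have "x $ j $ i = x $ i $ j" for i j
    using assms(1) by (metis transpose_def vec_lambda_beta)
  then have "transpose (half_space_point l x) = half_space_point l x"
    by (auto simp: transpose_def half_space_point_def vec_eq_iff)
  moreover have Im: "map_matrix Im (half_space_point l x) = mat l"
    by (simp add: half_space_point_def mat_def vec_eq_iff)
  moreover have "mat l *v v = l *\<^sub>R v" for v :: "real^'n"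
    by (simp add: matrix_vector_mult_def mat_def vec_eq_iff if_distrib[of "\<lambda>x. x * _"] cong: if_cong)
  then have "pos_def_matrix (mat l :: real^'n^'n)"
    using assms(2) by (simp add: pos_def_matrix_def transpose_mat)
  ultimately show ?thesis by (simp add: siegel_half_space_def)
qed

lemma tr_char_half_space_point:
  fixes t x :: "real^'n^'n"
  assumes x: "transpose x = x"
  shows "tr_char t (half_space_point l x) = of_real (exp (- 2 * pi * l * trace t)) * cis (2 * pi * (t \<bullet> x))"
proof -
  have "x $ j $ i = x $ i $ j" for i j
    using x by (metis transpose_def vec_lambda_beta)
  then have "trace (map_matrix of_real t ** half_space_point l x) = Complex (t \<bullet> x) (l * trace t)"
    by (simp add: trace_def matrix_matrix_mult_def half_space_point_def inner_vec_def complex_eq_iff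
        sum_distrib_left mult_ac if_distrib[of "\<lambda>x. _ * x"] cong: if_cong)
  moreover have "2 * of_real pi * \<i> * Complex a b = of_real (- 2 * pi * b) + \<i> * of_real (2 * pi * a)" for a b
    by (simp add: complex_eq_iff)
  ultimately show ?thesis
    unfolding tr_char_def e_char_def
    by (simp only: exp_add cis_conv_exp exp_of_real) (simp add: mult.assoc)
qed

lemma automorphy_matrix_half_space_point:
  "automorphy_matrix M (half_space_point l x) =
     pencil (map_matrix of_int (block_c M))
       (map_matrix of_int (block_c M) ** x + map_matrix of_int (block_d M)) (\<i> * of_real l)"
  by (auto simp: automorphy_matrix_def pencil_def half_space_point_def vec_eq_iff matrix_matrix_mult_def
      complex_eq_iff if_distrib[of "\<lambda>x. _ * x"] cong: if_cong)

lemma map_matrix_of_int_minus: "map_matrix of_int (- A) = - map_matrix of_int A"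
  by (simp add: vec_eq_iff)

lemma map_matrix_of_int_diff: "map_matrix of_int (A - B) = map_matrix of_int A - map_matrix of_int B"
  by (simp add: vec_eq_iff)

lemma map_matrix_transpose: "map_matrix f (transpose A) = transpose (map_matrix f A)"
  by (simp add: vec_eq_iff transpose_def)

text \<open>These are the hypotheses \<open>sym\<close> and \<open>bez\<close> of the pencil lemmas,
  with X = -b^T and Y = a^T.\<close>

lemma Sp_int_pencil_hyps:
  fixes M :: "int^('n::finite + 'n)^('n + 'n)"
  assumes "M \<in> Sp_int"
  defines "C \<equiv> map_matrix real_of_int (block_c M)" and "D \<equiv> map_matrix real_of_int (block_d M)"
  shows "D ** transpose C = C ** transpose D"
    and "C ** map_matrix of_int (- transpose (block_b M)) + D ** map_matrix of_int (transpose (block_a M)) = mat 1"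
proof -
  show "D ** transpose C = C ** transpose D"
    unfolding C_def D_def map_matrix_transpose[symmetric] map_matrix_of_int_mult[symmetric]
    by (simp add: Sp_int_right_equations(2)[OF assms(1)])
  have "map_matrix real_of_int (block_d M ** transpose (block_a M) - block_c M ** transpose (block_b M)) = mat 1"
    by (simp add: Sp_int_right_equations(4)[OF assms(1)] map_matrix_of_int_mat_1)
  then show "C ** map_matrix of_int (- transpose (block_b M)) + D ** map_matrix of_int (transpose (block_a M)) = mat 1"
    by (simp add: C_def D_def map_matrix_of_int_minus map_matrix_of_int_diff map_matrix_of_int_mult
        matrix_mult_minus_right)
qed

lemma norm_det_automorphy_ge:
  fixes M :: "int^('n::finite + 'n)^('n + 'n)"
  assumes M: "M \<in> Sp_int" and c: "block_c M \<noteq> 0" and x: "transpose x = x" and l: "l \<ge> 1"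
  shows "l \<le> norm (det (automorphy_matrix M (half_space_point l x)))"
  unfolding automorphy_matrix_half_space_point
proof (rule norm_det_pencil_ge[OF Sp_int_pencil_hyps[OF M] _ _ _ x l])
  show "map_matrix real_of_int (block_c M) \<noteq> 0" using c by (simp add: vec_eq_iff)
qed auto

lemma automorphy_parabolic:
  assumes "block_c M = 0"
  shows "automorphy_matrix M z = map_matrix of_int (block_d M)"
  by (simp add: assms automorphy_matrix_def matrix_matrix_mult_def vec_eq_iff)

lemma det_map_matrix_of_int:
  "det (map_matrix (of_int :: int \<Rightarrow> 'a::comm_ring_1) A) = of_int (det A)"
  by (simp add: det_def)

lemma det_automorphy_parabolic:
  fixes M :: "int^('n::finite + 'n)^('n + 'n)"
  assumes M: "M \<in> Sp_int" and c: "block_c M = 0"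
  shows "det (automorphy_matrix M z) = 1 \<or> det (automorphy_matrix M z) = - 1"
proof -
  have "det (block_d M) * det (transpose (block_a M)) = 1"
    using parabolic_inverse(2)[OF M c] by (metis det_I det_mul)
  then have "det (block_d M) = 1 \<or> det (block_d M) = - 1"
    by (metis zmult_eq_1_iff)
  then show ?thesis
    by (auto simp: automorphy_parabolic[OF c] det_map_matrix_of_int)
qed

lemma automorphy_matrix_inverse:
  fixes M :: "int^('n::finite + 'n)^('n + 'n)"
  assumes M: "M \<in> Sp_int" and x: "transpose x = x" and l: "l \<ge> 1"
  defines "w \<equiv> automorphy_matrix M (half_space_point l x)"
  shows "det w \<noteq> 0" "matrix_inv w ** w = mat 1" "w ** matrix_inv w = mat 1"
proof -
  show d: "det w \<noteq> 0"
  proof (cases "block_c M = 0")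
    case True
    then show ?thesis using det_automorphy_parabolic[OF M True, of "half_space_point l x"] by (auto simp: w_def)
  next
    case False
    then show ?thesis using norm_det_automorphy_ge[OF M False x l] l by (auto simp: w_def)
  qed
  then have "\<exists>v. w ** v = mat 1 \<and> v ** w = mat 1"
    using invertible_det_nz[of w] by (auto simp: invertible_def)
  then show "matrix_inv w ** w = mat 1" "w ** matrix_inv w = mat 1"
    unfolding matrix_inv_def by (metis (mono_tags, lifting) someI_ex)+
qed

section \<open>Decay of the exponential factor\<close>

lemma pos_def_matrix_lower_bound:
  fixes s :: "real^'n^'n"
  assumes "pos_def_matrix s"
  obtains e where "e > 0" "\<And>v. e * (norm v)\<^sup>2 \<le> v \<bullet> (s *v v)"
proof -
  have "continuous_on (sphere 0 1) (\<lambda>v. v \<bullet> (s *v v))"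
    by (intro continuous_intros matrix_vector_mult_linear_continuous_on)
  moreover have "sphere (0 :: real^'n) 1 \<noteq> {}"
    using norm_axis_1 by (auto simp: sphere_def intro!: exI[of _ "axis undefined 1"])
  \<comment> \<open>The constant is the minimum of the quadratic form on the compact unit sphere;
    homogeneity extends the bound to all vectors.\<close>
  ultimately obtain u where u: "u \<in> sphere 0 1" "\<And>v. v \<in> sphere 0 1 \<Longrightarrow> u \<bullet> (s *v u) \<le> v \<bullet> (s *v v)"
    using continuous_attains_inf[of "sphere 0 1" "\<lambda>v. v \<bullet> (s *v v)"] by (metis compact_sphere)
  have "u \<noteq> 0" using u(1) by auto
  then have pos: "u \<bullet> (s *v u) > 0" using assms by (simp add: pos_def_matrix_def)
  have "(u \<bullet> (s *v u)) * (norm v)\<^sup>2 \<le> v \<bullet> (s *v v)" for v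
  proof (cases "v = 0")
    case False
    then have "(1 / norm v) *\<^sub>R v \<in> sphere 0 1" by simp
    from u(2)[OF this] have "u \<bullet> (s *v u) \<le> (1 / (norm v)\<^sup>2) * (v \<bullet> (s *v v))"
      by (simp add: matrix_vector_mult_scaleR power2_eq_square divide_inverse mult_ac)
    then show ?thesis using False by (simp add: field_simps)
  qed simp
  then show thesis using that pos by blast
qed

abbreviation cadjoint :: "complex^'n^'m \<Rightarrow> complex^'m^'n" where
  "cadjoint A \<equiv> map_matrix cnj (transpose A)"

lemma cadjoint_mult: "cadjoint (A ** B) = cadjoint B ** cadjoint A"
  by (simp add: vec_eq_iff matrix_matrix_mult_def transpose_def mult.commute)

text \<open>
  With \<open>w = c z + d\<close> and \<open>v = w\<^sup>-\<^sup>1\<close>, the imaginary part of \<open>\<gamma> \<cdot> z\<close> is \<open>l v\<^sup>* v\<close>.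
\<close>

lemma Im_trace_siegel_action:
  fixes M :: "int^('n::finite + 'n)^('n + 'n)" and s :: "real^'n^'n"
  assumes M: "M \<in> Sp_int" and x: "transpose x = x" and l: "l \<ge> 1" and s: "transpose s = s"
  defines "v \<equiv> matrix_inv (automorphy_matrix M (half_space_point l x))"
  shows "Im (trace (map_matrix of_real s ** siegel_action M (half_space_point l x)))
    = l * (\<Sum>i\<in>UNIV. \<Sum>j\<in>UNIV. \<Sum>k\<in>UNIV. s $ j $ k * Re (v $ i $ j * cnj (v $ i $ k)))"
proof -
  define z where "z = half_space_point l x"
  define a where "a = map_matrix complex_of_int (block_a M)"
  define b where "b = map_matrix complex_of_int (block_b M)"
  define c where "c = map_matrix complex_of_int (block_c M)"
  define d where "d = map_matrix complex_of_int (block_d M)"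
  define w where "w = c ** z + d"
  define P where "P = a ** z + b"
  define Z where "Z = P ** v"
  have w: "w = automorphy_matrix M z" by (simp add: w_def automorphy_matrix_def c_def d_def)
  have wv: "w ** v = mat 1"
    unfolding w v_def z_def by (rule automorphy_matrix_inverse[OF M x l])
  have Z: "siegel_action M z = Z"
    by (simp add: siegel_action_def Z_def P_def a_def b_def v_def z_def)
  have real: "cadjoint a = transpose a" "cadjoint b = transpose b" "cadjoint c = transpose c" "cadjoint d = transpose d"
    by (simp_all add: a_def b_def c_def d_def vec_eq_iff transpose_def)
  have adj_add: "cadjoint (A + B) = cadjoint A + cadjoint B" for A B :: "complex^'n^'n"
    by (simp add: vec_eq_iff transpose_def)
  have adj_1: "cadjoint (mat 1) = (mat 1 :: complex^'n^'n)"
    by (simp add: mat_def vec_eq_iff transpose_def)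
  have eqs: "transpose a ** c = transpose c ** a" "transpose b ** d = transpose d ** b"
    "transpose a ** d = mat 1 + transpose c ** b" "transpose d ** a = mat 1 + transpose b ** c"
  proof -
    note E = Sp_int_left_equations[OF M]
    show "transpose a ** c = transpose c ** a" "transpose b ** d = transpose d ** b"
      unfolding a_def b_def c_def d_def map_matrix_transpose[symmetric] map_matrix_of_int_mult[symmetric]
      by (simp_all add: E)
    have "map_matrix complex_of_int (transpose (block_a M) ** block_d M - transpose (block_c M) ** block_b M) = mat 1"
      by (simp add: E map_matrix_of_int_mat_1)
    then show *: "transpose a ** d = mat 1 + transpose c ** b"
      by (simp add: a_def b_def c_def d_def map_matrix_of_int_diff map_matrix_of_int_mult map_matrix_transpose
          algebra_simps)
    have "transpose (A + B) = transpose A + transpose B" for A B :: "complex^'n^'n"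
      by (simp add: vec_eq_iff transpose_def)
    then show "transpose d ** a = mat 1 + transpose b ** c"
      using arg_cong[OF *, of transpose] by (simp add: matrix_transpose_mul transpose_mat)
  qed
  have "cadjoint w ** P = cadjoint z ** (transpose c ** a) ** z + cadjoint z ** (transpose c ** b)
      + (transpose d ** a) ** z + transpose d ** b"
    by (simp add: w_def P_def adj_add cadjoint_mult real matrix_add_ldistrib matrix_matrix_add_rdistrib
        matrix_mul_assoc add_ac)
  moreover have "cadjoint P ** w = cadjoint z ** (transpose a ** c) ** z + cadjoint z ** (transpose a ** d)
      + (transpose b ** c) ** z + transpose b ** d"
    by (simp add: w_def P_def adj_add cadjoint_mult real matrix_add_ldistrib matrix_matrix_add_rdistrib
        matrix_mul_assoc add_ac)
  \<comment> \<open>Symmetry of a^T c and of b^T d cancels the terms quadratic in z and the constant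
    terms; a^T d - c^T b = 1 and its transpose leave z minus its adjoint.\<close>
  ultimately have "cadjoint w ** P - cadjoint P ** w = z - cadjoint z"
    by (simp add: eqs matrix_add_ldistrib matrix_matrix_add_rdistrib algebra_simps)
  also have "\<dots> = mat (2 * \<i> * of_real l)"
  proof -
    have "x $ j $ i = x $ i $ j" for i j
      using x by (metis transpose_def vec_lambda_beta)
    then show ?thesis
      by (auto simp: z_def half_space_point_def mat_def vec_eq_iff transpose_def complex_eq_iff)
  qed
  finally have wP: "cadjoint w ** P - cadjoint P ** w = mat (2 * \<i> * of_real l)" .
  have "cadjoint v ** (cadjoint w ** P - cadjoint P ** w) ** v
      = cadjoint (w ** v) ** (P ** v) - cadjoint (P ** v) ** (w ** v)"
    by (simp add: cadjoint_mult matrix_mul_assoc matrix_matrix_diff_ldistrib)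
       (simp add: matrix_matrix_mult_def vec_eq_iff left_diff_distrib sum_subtractf)
  also have "\<dots> = Z - cadjoint Z"
    unfolding wv adj_1 by (simp add: Z_def)
  finally have ZZ: "Z - cadjoint Z = cadjoint v ** mat (2 * \<i> * of_real l) ** v"
    using wP by simp
  have ZZ': "Z $ k $ j - cnj (Z $ j $ k) = 2 * \<i> * of_real l * (\<Sum>i\<in>UNIV. cnj (v $ i $ k) * v $ i $ j)" for j k
  proof -
    have "Z $ k $ j - cnj (Z $ j $ k) = (Z - cadjoint Z) $ k $ j" by (simp add: transpose_def)
    also have "\<dots> = 2 * \<i> * of_real l * (\<Sum>i\<in>UNIV. cnj (v $ i $ k) * v $ i $ j)"
      unfolding ZZ by (simp add: matrix_matrix_mult_def mat_def transpose_def sum_distrib_left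
          if_distrib[of "\<lambda>x. _ * x"] mult_ac cong: if_cong)
    finally show ?thesis .
  qed
  have ssym: "s $ k $ j = s $ j $ k" for j k
    using s by (metis transpose_def vec_lambda_beta)
  \<comment> \<open>Since \<open>s\<close> is symmetric, \<open>T - cnj T\<close> pairs
    \<open>s\<close> with \<open>Z - cadjoint Z\<close>, so the difference computed above determines
    the imaginary part of the trace.\<close>
  define T where "T = (\<Sum>j\<in>UNIV. \<Sum>k\<in>UNIV. of_real (s $ j $ k) * Z $ k $ j)"
  have "cnj T = (\<Sum>k\<in>UNIV. \<Sum>j\<in>UNIV. of_real (s $ j $ k) * cnj (Z $ k $ j))"
    unfolding T_def by (subst sum.swap) simp
  then have "T - cnj T = (\<Sum>j\<in>UNIV. \<Sum>k\<in>UNIV. of_real (s $ j $ k) * (Z $ k $ j - cnj (Z $ j $ k)))"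
    by (simp add: T_def ssym right_diff_distrib sum_subtractf)
  also have "\<dots> = (\<Sum>j\<in>UNIV. \<Sum>k\<in>UNIV. \<Sum>i\<in>UNIV. 2 * \<i> * of_real l * (of_real (s $ j $ k) * (v $ i $ j * cnj (v $ i $ k))))"
    unfolding ZZ' by (simp add: sum_distrib_left mult_ac)
  also have "\<dots> = (\<Sum>i\<in>UNIV. \<Sum>j\<in>UNIV. \<Sum>k\<in>UNIV. 2 * \<i> * of_real l * (of_real (s $ j $ k) * (v $ i $ j * cnj (v $ i $ k))))"
    by (subst (2) sum.swap, subst sum.swap, rule sum.cong[OF refl], rule refl)
  also have "\<dots> = 2 * \<i> * of_real l * (\<Sum>i\<in>UNIV. \<Sum>j\<in>UNIV. \<Sum>k\<in>UNIV. of_real (s $ j $ k) * (v $ i $ j * cnj (v $ i $ k)))"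
    by (simp only: sum_distrib_left)
  finally have "Im (T - cnj T) = Im \<dots>" by (rule arg_cong)
  then have "2 * Im T = 2 * l * Re (\<Sum>i\<in>UNIV. \<Sum>j\<in>UNIV. \<Sum>k\<in>UNIV. of_real (s $ j $ k) * (v $ i $ j * cnj (v $ i $ k)))"
    by simp
  then have "Im T = l * (\<Sum>i\<in>UNIV. \<Sum>j\<in>UNIV. \<Sum>k\<in>UNIV. s $ j $ k * Re (v $ i $ j * cnj (v $ i $ k)))"
    by simp
  moreover have "trace (map_matrix of_real s ** siegel_action M z) = T"
    by (simp add: trace_def matrix_matrix_mult_def Z T_def)
  ultimately show ?thesis by (simp add: z_def)
qed

section \<open>Absolute convergence of the Poincare series\<close>

definition poincare_term ::
  "real^'n^'n \<Rightarrow> nat \<Rightarrow> int^('n::finite + 'n)^('n + 'n) \<Rightarrow> complex^'n^'n \<Rightarrow> complex" where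
  "poincare_term s k M z = det (automorphy_matrix M z) powi (- int k) * tr_char s (siegel_action M z)"

lemma poincare_series_eq:
  "poincare_series s k z = (\<Sum>\<^sub>\<infinity>C \<in> Sp_int // left_coset_rel. poincare_term s k (coset_rep C) z)"
  by (simp add: poincare_series_def poincare_term_def coset_rep_def Let_def)

lemma norm_e_char: "norm (e_char w) = exp (- 2 * pi * Im w)"
  by (simp add: e_char_def)

lemma norm_poincare_term:
  "norm (poincare_term s k M z) =
     norm (tr_char s (siegel_action M z)) / norm (det (automorphy_matrix M z)) ^ k"
  by (simp add: poincare_term_def norm_mult norm_power norm_inverse power_int_minus divide_inverse)

text \<open>The imaginary part of the trace is l times a sum, over the rows of (c z + d)^-1, of the
  quadratic form of \<open>s\<close> at their real and imaginary parts. Positive definiteness and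
  \<open>l >= 1\<close> turn this into Gaussian decay in the size of that inverse.\<close>

lemma norm_tr_char_siegel_action_le:
  fixes s :: "real^'n^'n"
  assumes s: "pos_def_matrix s"
  obtains e where "e > 0" "\<And>M x l. M \<in> Sp_int \<Longrightarrow> transpose x = x \<Longrightarrow> l \<ge> 1 \<Longrightarrow>
    norm (tr_char s (siegel_action M (half_space_point l x)))
      \<le> exp (- e * (\<Sum>i\<in>UNIV. \<Sum>j\<in>UNIV.
          (norm (matrix_inv (automorphy_matrix M (half_space_point l x)) $ i $ j))\<^sup>2))"
proof -
  obtain e where e: "e > 0" "\<And>v. e * (norm v)\<^sup>2 \<le> v \<bullet> (s *v v)"
    using pos_def_matrix_lower_bound[OF s] by blast
  have norm2: "(norm v)\<^sup>2 = (\<Sum>j\<in>UNIV. (v $ j)\<^sup>2)" for v :: "real^'n"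
    unfolding power2_norm_eq_inner by (simp add: inner_vec_def power2_eq_square)
  have "norm (tr_char s (siegel_action M (half_space_point l x)))
      \<le> exp (- (2 * pi * e) * (\<Sum>i\<in>UNIV. \<Sum>j\<in>UNIV.
          (norm (matrix_inv (automorphy_matrix M (half_space_point l x)) $ i $ j))\<^sup>2))"
    if M: "M \<in> Sp_int" and x: "transpose x = x" and l: "l \<ge> 1" for M x l
  proof -
    let ?v = "matrix_inv (automorphy_matrix M (half_space_point l x))"
    have row: "e * (\<Sum>j\<in>UNIV. (norm (?v $ i $ j))\<^sup>2)
        \<le> (\<Sum>j\<in>UNIV. \<Sum>k\<in>UNIV. s $ j $ k * Re (?v $ i $ j * cnj (?v $ i $ k)))" for i
    proof -
      define p where "p = (\<chi> j. Re (?v $ i $ j))"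
      define q where "q = (\<chi> j. Im (?v $ i $ j))"
      have "e * (\<Sum>j\<in>UNIV. (norm (?v $ i $ j))\<^sup>2) = e * (norm p)\<^sup>2 + e * (norm q)\<^sup>2"
        by (simp add: norm2 p_def q_def cmod_power2 sum.distrib distrib_left)
      also have "\<dots> \<le> p \<bullet> (s *v p) + q \<bullet> (s *v q)"
        by (intro add_mono e)
      also have "\<dots> = (\<Sum>j\<in>UNIV. \<Sum>k\<in>UNIV. s $ j $ k * Re (?v $ i $ j * cnj (?v $ i $ k)))"
        by (simp add: inner_vec_def matrix_vector_mult_def p_def q_def sum_distrib_left
            sum.distrib algebra_simps)
      finally show ?thesis .
    qed
    let ?N = "\<Sum>i\<in>UNIV. \<Sum>j\<in>UNIV. (norm (?v $ i $ j))\<^sup>2"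
    have N: "e * ?N \<ge> 0" using e(1) by (intro mult_nonneg_nonneg sum_nonneg) auto
    have "e * ?N \<le> l * (e * ?N)" using N l by (simp add: mult_le_cancel_right1)
    also have "\<dots> \<le> l * (\<Sum>i\<in>UNIV. \<Sum>j\<in>UNIV. \<Sum>k\<in>UNIV. s $ j $ k * Re (?v $ i $ j * cnj (?v $ i $ k)))"
      using l row by (intro mult_left_mono) (auto simp only: sum_distrib_left intro: sum_mono)
    also have "\<dots> = Im (trace (map_matrix of_real s ** siegel_action M (half_space_point l x)))"
      using s by (intro Im_trace_siegel_action[OF M x l, symmetric]) (simp add: pos_def_matrix_def)
    finally have "2 * pi * (e * ?N) \<le> 2 * pi * Im (trace (map_matrix of_real s ** siegel_action M (half_space_point l x)))"
      by (intro mult_left_mono) auto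
    then show ?thesis by (simp add: tr_char_def norm_e_char mult_ac)
  qed
  then show thesis using e(1) that[of "2 * pi * e"] by auto
qed

text \<open>A product of 2 g^2 inverse squares, one per entry of (c, d): summable over all pairs,
  and of total degree 4 g^2, the weight at which the series is compared with it.\<close>

definition pair_weight :: "int^'n^'n \<Rightarrow> int^'n^'n \<Rightarrow> real" where
  "pair_weight c d = (\<Prod>i\<in>UNIV. \<Prod>j\<in>UNIV. 1 / (1 + \<bar>real_of_int (c $ i $ j)\<bar>)\<^sup>2) *
             (\<Prod>i\<in>UNIV. \<Prod>j\<in>UNIV. 1 / (1 + \<bar>real_of_int (d $ i $ j)\<bar>)\<^sup>2)"

lemma pair_weight_nonneg: "0 \<le> pair_weight c d"
  unfolding pair_weight_def by (intro mult_nonneg_nonneg prod_nonneg) auto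

lemma pair_weight_ge:
  fixes c d :: "int^'n^'n"
  assumes "\<And>i j. 1 + \<bar>real_of_int (c $ i $ j)\<bar> \<le> B" "\<And>i j. 1 + \<bar>real_of_int (d $ i $ j)\<bar> \<le> B"
  shows "1 / B ^ (4 * CARD('n)\<^sup>2) \<le> pair_weight c d"
proof -
  have B: "B > 0" using assms(1)[of undefined undefined] by linarith
  have "((1 / B\<^sup>2) ^ CARD('n)) ^ CARD('n)
      \<le> (\<Prod>i\<in>UNIV. \<Prod>j\<in>UNIV. 1 / (1 + \<bar>real_of_int (c $ i $ j)\<bar>)\<^sup>2)"
    if "\<And>i j. 1 + \<bar>real_of_int (c $ i $ j)\<bar> \<le> B" for c :: "int^'n^'n"
  proof -
    have "(\<Prod>i\<in>(UNIV::'n set). \<Prod>j\<in>(UNIV::'n set). 1 / B\<^sup>2)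
        \<le> (\<Prod>i\<in>UNIV. \<Prod>j\<in>UNIV. 1 / (1 + \<bar>real_of_int (c $ i $ j)\<bar>)\<^sup>2)"
      using B that by (intro prod_mono conjI prod_nonneg divide_left_mono power_mono) auto
    then show ?thesis by simp
  qed
  then have "((1 / B\<^sup>2) ^ CARD('n)) ^ CARD('n) * ((1 / B\<^sup>2) ^ CARD('n)) ^ CARD('n) \<le> pair_weight c d"
    unfolding pair_weight_def using assms B by (intro mult_mono prod_nonneg) auto
  moreover have "((1 / B\<^sup>2) ^ CARD('n)) ^ CARD('n) * ((1 / B\<^sup>2) ^ CARD('n)) ^ CARD('n)
      = 1 / B ^ (2 * (CARD('n) * CARD('n)) + 2 * (CARD('n) * CARD('n)))"
    by (simp only: power_one_over power_add power_mult) simp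
  then have "((1 / B\<^sup>2) ^ CARD('n)) ^ CARD('n) * ((1 / B\<^sup>2) ^ CARD('n)) ^ CARD('n) = 1 / B ^ (4 * CARD('n)\<^sup>2)"
    by (simp add: power2_eq_square)
  ultimately show ?thesis by simp
qed

text \<open>
  Cramer's rule bounds the entries of \<open>w = c z + d\<close> by \<open>\<bar>det w\<bar> (1 + R)\<^sup>g\<close>, where \<open>R\<close> is the size of
  \<open>w\<^sup>-\<^sup>1\<close>, and the factor \<open>(1 + R)\<^sup>g\<^sup>k\<close> is absorbed by the exponential decay in \<open>R\<^sup>2\<close>.
\<close>

lemma norm_poincare_term_le_pair_weight:
  fixes s :: "real^'n^'n"
  assumes s: "pos_def_matrix s"
  obtains K where "K \<ge> 0" and
    "\<And>M x l. M \<in> Sp_int \<Longrightarrow> transpose x = x \<Longrightarrow> (\<And>i j. \<bar>x $ i $ j\<bar> \<le> 1) \<Longrightarrow> l \<ge> 1 \<Longrightarrow>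
      norm (poincare_term s (4 * CARD('n)\<^sup>2) M (half_space_point l x))
        \<le> K * pair_weight (block_c M) (block_d M)"
proof -
  define m where "m = 4 * CARD('n)\<^sup>2"
  define g where "g = CARD('n)"
  define A where "A = (fact g :: real)"
  \<comment> \<open>With \<open>1 <= T\<close>, \<open>|c| <= T\<close> and
    \<open>|d| <= T + g T\<close> entrywise, both \<open>1 + |c|\<close> and \<open>1 + |d|\<close>
    are at most \<open>(2 + g) * T\<close>.\<close>
  define E where "E = 2 + real g"
  obtain e where e: "e > 0" "\<And>M x l. M \<in> Sp_int \<Longrightarrow> transpose x = x \<Longrightarrow> l \<ge> 1 \<Longrightarrow>
    norm (tr_char s (siegel_action M (half_space_point l x)))
      \<le> exp (- e * (\<Sum>i\<in>UNIV. \<Sum>j\<in>UNIV.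
          (norm (matrix_inv (automorphy_matrix M (half_space_point l x)) $ i $ j))\<^sup>2))"
    using norm_tr_char_siegel_action_le[OF s] by blast
  obtain K where K: "\<And>r. 0 \<le> r \<Longrightarrow> (1 + r) ^ (g * m) * exp (- e * r\<^sup>2) \<le> K"
    using polynomial_gaussian_bound[OF e(1)] by blast
  have K0: "K \<ge> 0" using K[of 0] by simp
  have E0: "E > 0" and A0: "A > 0" by (simp_all add: E_def A_def add_pos_nonneg)
  show thesis
  proof (rule that[of "(E * A) ^ m * K"])
    show "(E * A) ^ m * K \<ge> 0" using K0 E0 A0 by simp
    fix M :: "int^('n + 'n)^('n + 'n)" and x :: "real^'n^'n" and l :: real
    assume M: "M \<in> Sp_int" and x: "transpose x = x" and x1: "\<And>i j. \<bar>x $ i $ j\<bar> \<le> 1" and l: "l \<ge> 1"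
    define w where "w = automorphy_matrix M (half_space_point l x)"
    define v where "v = matrix_inv w"
    define R where "R = sqrt (\<Sum>i\<in>UNIV. \<Sum>j\<in>UNIV. (norm (v $ i $ j))\<^sup>2)"
    define T where "T = norm (det w) * (A * (1 + R) ^ g)"
    have R2: "R\<^sup>2 = (\<Sum>i\<in>UNIV. \<Sum>j\<in>UNIV. (norm (v $ i $ j))\<^sup>2)" and R0: "R \<ge> 0"
      by (auto simp: R_def intro!: sum_nonneg)
    have vR: "norm (v $ i $ j) \<le> R" for i j
    proof (rule power2_le_imp_le)
      have "(norm (v $ i $ j))\<^sup>2 \<le> (\<Sum>j\<in>UNIV. (norm (v $ i $ j))\<^sup>2)"
        by (rule member_le_sum) auto
      also have "\<dots> \<le> R\<^sup>2"
        unfolding R2 by (rule member_le_sum) (auto intro: sum_nonneg)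
      finally show "(norm (v $ i $ j))\<^sup>2 \<le> R\<^sup>2" .
    qed (rule R0)
    have vw: "v ** w = mat 1" and dw: "det w \<noteq> 0"
      unfolding v_def w_def by (rule automorphy_matrix_inverse[OF M x l])+
    have wT: "norm (w $ i $ j) \<le> T" for i j
      unfolding T_def A_def g_def by (rule norm_entry_le_det_mult[OF vw vR])
    have T1: "1 \<le> T"
      unfolding T_def A_def g_def by (rule one_le_det_mult[OF vw vR])
    have w_entry: "w $ i $ j = of_real ((\<Sum>k\<in>UNIV. block_c M $ i $ k * x $ k $ j) + block_d M $ i $ j)
        + \<i> * of_real (l * block_c M $ i $ j)" for i j
      by (simp add: w_def automorphy_matrix_half_space_point pencil_def matrix_matrix_mult_def)
    \<comment> \<open>The imaginary part of c z + d is l c, which bounds c since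
      \<open>l >= 1\<close>; its real part is c x + d, and subtracting c x to reach d is where the
      entries of x must be bounded.\<close>
    have cT: "\<bar>real_of_int (block_c M $ i $ j)\<bar> \<le> T" for i j
    proof -
      have "\<bar>real_of_int (block_c M $ i $ j)\<bar> \<le> l * \<bar>real_of_int (block_c M $ i $ j)\<bar>"
        using l by (simp add: mult_le_cancel_right1)
      also have "\<dots> = \<bar>Im (w $ i $ j)\<bar>" using l by (simp add: w_entry abs_mult)
      also have "\<dots> \<le> T" using abs_Im_le_cmod wT order_trans by blast
      finally show ?thesis .
    qed
    have dT: "\<bar>real_of_int (block_d M $ i $ j)\<bar> \<le> T + real g * T" for i j
    proof -
      have "real_of_int (block_d M $ i $ j) = Re (w $ i $ j) - (\<Sum>k\<in>UNIV. block_c M $ i $ k * x $ k $ j)"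
        by (simp add: w_entry)
      then have "\<bar>real_of_int (block_d M $ i $ j)\<bar> \<le> \<bar>Re (w $ i $ j)\<bar> + \<bar>\<Sum>k\<in>UNIV. block_c M $ i $ k * x $ k $ j\<bar>"
        by linarith
      also have "\<dots> \<le> T + (\<Sum>k\<in>(UNIV::'n set). T)"
      proof (intro add_mono order_trans[OF sum_abs] sum_mono)
        show "\<bar>Re (w $ i $ j)\<bar> \<le> T" using abs_Re_le_cmod wT order_trans by blast
        show "\<bar>block_c M $ i $ k * x $ k $ j\<bar> \<le> T" for k
          using mult_mono[OF cT[of i k] x1[of k j]] T1 by (simp add: abs_mult)
      qed
      finally show ?thesis by (simp add: g_def)
    qed
    have "1 / (E * T) ^ m \<le> pair_weight (block_c M) (block_d M)"
      unfolding m_def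
    proof (rule pair_weight_ge)
      fix i j
      have gT: "0 \<le> real g * T" using T1 by simp
      show "1 + \<bar>real_of_int (block_c M $ i $ j)\<bar> \<le> E * T"
        and "1 + \<bar>real_of_int (block_d M $ i $ j)\<bar> \<le> E * T"
        using cT[of i j] dT[of i j] T1 gT unfolding E_def distrib_right by linarith+
    qed
    then have pw: "(E * A) ^ m * K * (1 / (E * T) ^ m) \<le> (E * A) ^ m * K * pair_weight (block_c M) (block_d M)"
      using K0 E0 A0 by (intro mult_left_mono) auto
    have "norm (poincare_term s m M (half_space_point l x)) \<le> exp (- e * R\<^sup>2) / norm (det w) ^ m"
      unfolding norm_poincare_term R2 w_def[symmetric] v_def
      using e(2)[OF M x l] by (intro divide_right_mono) (simp_all add: w_def)
    also have "\<dots> \<le> (K / (1 + R) ^ (g * m)) / norm (det w) ^ m"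
      using K[OF R0] R0 by (intro divide_right_mono) (simp_all add: field_simps)
    \<comment> \<open>An exact cancellation: the exponent \<open>m\<close> in
      \<open>(E * T) ^ m\<close> is the weight, so the powers of \<open>det w\<close> and of
      \<open>1 + R\<close> on the two sides match.\<close>
    also have "\<dots> = (E * A) ^ m * K * (1 / (E * T) ^ m)"
      using E0 A0 R0 dw by (simp add: T_def power_mult_distrib power_mult field_simps)
    also note pw
    finally show "norm (poincare_term s (4 * CARD('n)\<^sup>2) M (half_space_point l x))
        \<le> (E * A) ^ m * K * pair_weight (block_c M) (block_d M)"
      by (simp add: m_def)
  qed
qed

text \<open>Distinct cosets have representatives with distinct lower rows, so this is a subsum of
  the sum over all pairs (c, d).\<close>

lemma pair_weight_summable_on_cosets:
  "(\<lambda>C. pair_weight (block_c (coset_rep C)) (block_d (coset_rep C)))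
     summable_on (Sp_int // left_coset_rel :: (int^('n::finite + 'n)^('n + 'n)) set set)"
proof -
  let ?f = "\<lambda>C :: (int^('n + 'n)^('n + 'n)) set. (block_c (coset_rep C), block_d (coset_rep C))"
  let ?Q = "Sp_int // left_coset_rel :: (int^('n + 'n)^('n + 'n)) set set"
  have inj: "inj_on ?f ?Q"
    by (rule inj_onI, rule coset_rep_eqI) auto
  have "(\<lambda>(c, d). pair_weight c d) summable_on (UNIV :: ((int^'n^'n) \<times> (int^'n^'n)) set)"
    unfolding pair_weight_def by (rule int_matrix_pair_weights_summable)
  then have "(\<lambda>(c, d). pair_weight c d) summable_on ?f ` ?Q"
    by (rule summable_on_subset_banach) auto
  then show ?thesis
    by (subst (asm) summable_on_reindex[OF inj]) (simp add: o_def)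
qed

section \<open>The parabolic cosets\<close>

text \<open>Diagonal terms are integers, and off-diagonal terms occur in equal pairs, each
  contributing \<open>(2 * s $ i $ j) * S $ i $ j\<close>.\<close>

lemma half_integral_pairing_in_Ints:
  fixes s :: "real^'n^'n" and S :: "int^'n^'n"
  assumes s: "s \<in> half_integral_pos_def" and S: "transpose S = S"
  shows "(\<Sum>i\<in>UNIV. \<Sum>j\<in>UNIV. s $ i $ j * of_int (S $ i $ j)) \<in> \<int>"
proof -
  define h where "h i j = s $ i $ j * of_int (S $ i $ j)" for i j
  have ssym: "s $ i $ j = s $ j $ i" for i j
    using s by (metis (mono_tags, lifting) half_integral_pos_def_def mem_Collect_eq pos_def_matrix_def
        transpose_def vec_lambda_beta)
  have Ssym: "S $ i $ j = S $ j $ i" for i j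
    using S by (metis transpose_def vec_lambda_beta)
  have hsym: "h i j = h j i" for i j unfolding h_def by (simp only: ssym[of i j] Ssym[of i j])
  \<comment> \<open>The index type carries no order; an injection into the naturals supplies one, so
    that each off-diagonal pair is counted once.\<close>
  obtain f :: "'n \<Rightarrow> nat" where f: "inj f"
    using finite_imp_inj_to_nat_seg[OF finite[of "UNIV :: 'n set"]] by blast
  let ?D = "\<lambda>i. {j. f j = f i}" and ?L = "\<lambda>i. {j. f j < f i}" and ?G = "\<lambda>i. {j. f i < f j}"
  have "(\<Sum>j\<in>UNIV. h i j) = (\<Sum>j\<in>?L i. h i j) + h i i + (\<Sum>j\<in>?G i. h i j)" for i
  proof -
    have "UNIV = (?L i \<union> ?D i) \<union> ?G i" by auto
    moreover have "?D i = {i}" using f by (auto dest: injD)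
    moreover have "(\<Sum>j\<in>(?L i \<union> ?D i) \<union> ?G i. h i j) = (\<Sum>j\<in>?L i. h i j) + (\<Sum>j\<in>?D i. h i j) + (\<Sum>j\<in>?G i. h i j)"
      by (subst sum.union_disjoint, simp, simp, force, subst sum.union_disjoint) auto
    ultimately show ?thesis by simp
  qed
  then have "(\<Sum>i\<in>UNIV. \<Sum>j\<in>UNIV. h i j)
      = (\<Sum>i\<in>UNIV. \<Sum>j\<in>?L i. h i j) + (\<Sum>i\<in>UNIV. h i i) + (\<Sum>i\<in>UNIV. \<Sum>j\<in>?G i. h i j)"
    by (simp add: sum.distrib)
  also have "(\<Sum>i\<in>UNIV. \<Sum>j\<in>?G i. h i j) = (\<Sum>j\<in>UNIV. \<Sum>i\<in>?L j. h i j)"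
    using sum.swap_restrict[of UNIV UNIV h "\<lambda>i j. f i < f j"] by simp
  also have "\<dots> = (\<Sum>i\<in>UNIV. \<Sum>j\<in>?L i. h i j)"
    by (intro sum.cong refl hsym)
  finally have eq: "(\<Sum>i\<in>UNIV. \<Sum>j\<in>UNIV. h i j) = (\<Sum>i\<in>UNIV. h i i) + (\<Sum>i\<in>UNIV. \<Sum>j\<in>?L i. 2 * h i j)"
    by (simp add: sum_distrib_left[symmetric])
  have "h i i \<in> \<int>" for i
    using s by (auto simp: h_def half_integral_pos_def_def)
  moreover have "2 * h i j \<in> \<int>" if "f j < f i" for i j
  proof -
    have "i \<noteq> j" using that by auto
    then have "(2 * s $ i $ j) * of_int (S $ i $ j) \<in> \<int>"
      using s by (intro Ints_mult[OF _ Ints_of_int]) (auto simp: half_integral_pos_def_def)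
    then show ?thesis by (simp add: h_def mult.assoc)
  qed
  ultimately show ?thesis
    unfolding h_def[symmetric] eq by (intro Ints_add Ints_sum) auto
qed

lemma e_char_add_Ints:
  assumes "m \<in> \<int>"
  shows "e_char (w + m) = e_char w"
proof -
  obtain n where "m = of_int n" using assms by (auto elim: Ints_cases)
  then have "2 * of_real pi * \<i> * (w + m) = 2 * of_real pi * \<i> * w + 2 * of_int n * of_real pi * \<i>"
    by (simp add: algebra_simps)
  then show ?thesis
    unfolding e_char_def by (simp only: exp_add) (simp add: exp_integer_2pi mult_ac)
qed

text \<open>The difference of \<open>x\<close> and its entrywise fractional part is a symmetric
  integer matrix, on which \<open>t\<close> takes integral values. It allows \<open>x\<close> to be
  moved into the unit box.\<close>

lemma tr_char_half_space_point_frac: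
  fixes t x :: "real^'n^'n"
  assumes t: "t \<in> half_integral_pos_def" and x: "transpose x = x"
  shows "tr_char t (half_space_point l (map_matrix frac x)) = tr_char t (half_space_point l x)"
proof -
  have sym: "transpose (map_matrix frac x) = map_matrix frac x" "transpose (map_matrix floor x) = map_matrix floor x"
    by (metis map_matrix_transpose x)+
  have "t \<bullet> x = (\<Sum>i\<in>UNIV. \<Sum>j\<in>UNIV. t $ i $ j * (frac (x $ i $ j) + of_int \<lfloor>x $ i $ j\<rfloor>))"
    by (simp add: inner_vec_def frac_def)
  also have "\<dots> = t \<bullet> map_matrix frac x + (\<Sum>i\<in>UNIV. \<Sum>j\<in>UNIV. t $ i $ j * of_int (map_matrix floor x $ i $ j))"
    by (simp add: inner_vec_def distrib_left sum.distrib)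
  finally obtain n :: int where "t \<bullet> x = t \<bullet> map_matrix frac x + of_int n"
    using half_integral_pairing_in_Ints[OF t sym(2)] by (auto elim!: Ints_cases)
  then have "cis (2 * pi * (t \<bullet> x)) = cis (2 * pi * (t \<bullet> map_matrix frac x)) * cis (2 * pi * of_int n)"
    by (simp only: cis_mult distrib_left)
  then show ?thesis
    by (simp add: tr_char_half_space_point[OF x] tr_char_half_space_point[OF sym(1)] cis_multiple_2pi)
qed

lemma gl_conj_uminus: "gl_conj (- a) s = gl_conj a s"
  by (simp add: gl_conj_def map_matrix_of_int_minus transpose_uminus matrix_mult_minus_left
      matrix_mult_minus_right)

lemma gl_conj_mult: "gl_conj (a ** b) s = gl_conj b (gl_conj a s)"
  by (simp add: gl_conj_def map_matrix_of_int_mult matrix_transpose_mul matrix_mul_assoc)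

lemma gl_conj_mat_1: "gl_conj (mat 1) s = s"
  by (simp add: gl_conj_def map_matrix_of_int_mat_1 transpose_mat)

lemma gl_conj_entry:
  "gl_conj a s $ i $ j = (\<Sum>k\<in>UNIV. \<Sum>l\<in>UNIV. s $ k $ l * of_int (a $ k $ i * a $ l $ j))"
proof -
  have "gl_conj a s $ i $ j = (\<Sum>l\<in>UNIV. \<Sum>k\<in>UNIV. s $ k $ l * of_int (a $ k $ i * a $ l $ j))"
    by (simp add: gl_conj_def matrix_matrix_mult_def transpose_def sum_distrib_left sum_distrib_right mult_ac)
  then show ?thesis by (subst sum.swap)
qed

text \<open>A diagonal entry is the pairing of \<open>s\<close> with a symmetric integer matrix of
  rank one, built from a column of \<open>a\<close>; twice any entry is an integral combination of
  the numbers \<open>2 * s $ k $ l\<close>.\<close>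

lemma gl_conj_half_integral:
  fixes s :: "real^'n^'n"
  assumes s: "s \<in> half_integral_pos_def" and a: "invertible a"
  shows "gl_conj a s \<in> half_integral_pos_def"
proof -
  let ?a = "map_matrix real_of_int a"
  have pd: "pos_def_matrix s" using s by (simp add: half_integral_pos_def_def)
  obtain a' where a': "a' ** a = mat 1" using a by (auto simp: invertible_def)
  have "transpose (gl_conj a s) = gl_conj a s"
    using pd by (simp add: gl_conj_def matrix_transpose_mul matrix_mul_assoc pos_def_matrix_def)
  moreover have "v \<bullet> (gl_conj a s *v v) > 0" if "v \<noteq> 0" for v
  proof -
    have "map_matrix real_of_int a' *v (?a *v v) = v"
      by (simp add: matrix_vector_mul_assoc a' map_matrix_of_int_mat_1 flip: map_matrix_of_int_mult)
    then have "?a *v v \<noteq> 0" using that by (metis matrix_vector_mult_0_right)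
    moreover have "v \<bullet> (gl_conj a s *v v) = (?a *v v) \<bullet> (s *v (?a *v v))"
      unfolding gl_conj_def
      by (simp add: dot_lmul_matrix[symmetric] matrix_vector_mul_assoc[symmetric] inner_commute)
         (metis dot_lmul_matrix inner_commute vector_transpose_matrix)
    ultimately show ?thesis using pd by (simp add: pos_def_matrix_def)
  qed
  moreover have "gl_conj a s $ i $ i \<in> \<int>" for i
    using half_integral_pairing_in_Ints[OF s, of "\<chi> k l. a $ k $ i * a $ l $ i"]
    by (simp add: gl_conj_entry transpose_def vec_eq_iff mult.commute)
  moreover have "2 * gl_conj a s $ i $ j \<in> \<int>" for i j
  proof -
    have "2 * s $ k $ l \<in> \<int>" for k l
      using s by (cases "k = l") (auto simp: half_integral_pos_def_def)
    then have "2 * s $ k $ l * of_int m \<in> \<int>" for k l m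
      by (rule Ints_mult[OF _ Ints_of_int])
    then show ?thesis
      unfolding gl_conj_entry sum_distrib_left by (intro Ints_sum) (simp only: mult.assoc)
  qed
  ultimately show ?thesis by (simp add: half_integral_pos_def_def pos_def_matrix_def)
qed

text \<open>The action is z -> a z a^T + b a^T. The translation b a^T is integral and symmetric, so
  the character ignores it, and the determinant is a sign raised to an even power. The result is
  independent of \<open>k\<close>.\<close>

lemma poincare_term_parabolic:
  fixes s :: "real^'n^'n"
  assumes s: "s \<in> half_integral_pos_def" and k: "even k"
    and M: "M \<in> Sp_int" and c: "block_c M = 0"
  shows "poincare_term s k M z = tr_char (gl_conj (block_a M) s) z"
proof -
  define a where "a = map_matrix complex_of_int (block_a M)"
  define b where "b = map_matrix complex_of_int (block_b M)"
  define d where "d = map_matrix complex_of_int (block_d M)"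
  define S where "S = block_b M ** transpose (block_a M)"
  let ?s = "map_matrix complex_of_real s"
  have da: "d ** transpose a = mat 1" "transpose a ** d = mat 1"
    using parabolic_inverse(1,2)[OF M c]
    by (simp_all add: a_def d_def map_matrix_of_int_mat_1 flip: map_matrix_transpose map_matrix_of_int_mult)
  have "\<exists>v. d ** v = mat 1 \<and> v ** d = mat 1" using da by blast
  then have "matrix_inv d ** d = mat 1"
    unfolding matrix_inv_def by (metis (mono_tags, lifting) someI_ex)
  then have inv: "matrix_inv d = transpose a"
    by (metis da(1) matrix_mul_assoc matrix_mul_lid matrix_mul_rid)
  have act: "siegel_action M z = (a ** z + b) ** transpose a"
    by (simp add: siegel_action_def automorphy_parabolic[OF c] a_def b_def inv[unfolded d_def a_def])
  have trS: "trace (?s ** (b ** transpose a)) \<in> \<int>"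
  proof -
    have "transpose S = S"
      by (simp add: S_def matrix_transpose_mul Sp_int_right_equations(1)[OF M])
    then have Ssym: "S $ i $ j = S $ j $ i" for i j by (metis transpose_def vec_lambda_beta)
    have "b ** transpose a = map_matrix of_int S"
      by (simp add: S_def a_def b_def map_matrix_of_int_mult map_matrix_transpose)
    then have "trace (?s ** (b ** transpose a)) = of_real (\<Sum>i\<in>UNIV. \<Sum>j\<in>UNIV. s $ i $ j * of_int (S $ j $ i))"
      by (simp add: trace_def matrix_matrix_mult_def)
    also have "(\<Sum>i\<in>UNIV. \<Sum>j\<in>UNIV. s $ i $ j * real_of_int (S $ j $ i)) = (\<Sum>i\<in>UNIV. \<Sum>j\<in>UNIV. s $ i $ j * of_int (S $ i $ j))"
      by (intro sum.cong refl, subst Ssym, rule refl)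
    finally have "trace (?s ** (b ** transpose a)) = of_real (\<Sum>i\<in>UNIV. \<Sum>j\<in>UNIV. s $ i $ j * of_int (S $ i $ j))" .
    moreover obtain m where "(\<Sum>i\<in>UNIV. \<Sum>j\<in>UNIV. s $ i $ j * of_int (S $ i $ j)) = of_int m"
      using half_integral_pairing_in_Ints[OF s \<open>transpose S = S\<close>] by (auto elim!: Ints_cases)
    ultimately show ?thesis by (simp only: of_real_of_int_eq Ints_of_int)
  qed
  have "map_matrix complex_of_real (gl_conj (block_a M) s) = transpose a ** ?s ** a"
    by (simp add: gl_conj_def a_def vec_eq_iff matrix_matrix_mult_def transpose_def)
  then have "trace (map_matrix complex_of_real (gl_conj (block_a M) s) ** z) = trace (transpose a ** (?s ** (a ** z)))"
    by (simp add: matrix_mul_assoc)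
  also have "\<dots> = trace (?s ** (a ** z ** transpose a))"
    by (subst trace_mul_sym) (simp add: matrix_mul_assoc)
  finally have "trace (?s ** siegel_action M z)
      = trace (map_matrix complex_of_real (gl_conj (block_a M) s) ** z) + trace (?s ** (b ** transpose a))"
    by (simp add: act matrix_matrix_add_rdistrib matrix_add_ldistrib trace_add)
  then have "tr_char s (siegel_action M z) = tr_char (gl_conj (block_a M) s) z"
    by (simp add: tr_char_def e_char_add_Ints[OF trS])
  moreover have "det (automorphy_matrix M z) powi (- int k) = 1"
    using det_automorphy_parabolic[OF M c, of z] k by (auto simp: power_int_minus)
  ultimately show ?thesis by (simp add: poincare_term_def)
qed

section \<open>Counting representations of t by s\<close>

definition representations :: "real^'n^'n \<Rightarrow> real^'n^'n \<Rightarrow> (int^'n^'n) set" where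
  "representations s t = {a. invertible a \<and> gl_conj a s = t}"

lemma invertible_int_mult: "invertible (a :: int^'n^'n) \<Longrightarrow> invertible b \<Longrightarrow> invertible (a ** b)"
  unfolding invertible_def by (metis matrix_mul_assoc matrix_mul_rid)

text \<open>The set is empty or the coset of \<open>Aut s\<close> obtained by right multiplication
  with one solution.\<close>

lemma card_representations:
  fixes s t :: "real^'n^'n"
  shows "real (card (representations s t)) = delta' s t * real (card (Aut s))"
proof (cases "\<exists>a. invertible a \<and> t = gl_conj a s")
  case True
  then obtain a where a: "invertible a" "t = gl_conj a s" by blast
  then obtain a' where a': "a ** a' = mat 1" "a' ** a = mat 1" by (auto simp: invertible_def)
  then have inv: "invertible a'" by (auto simp: invertible_def)
  have "bij_betw (\<lambda>b. b ** a) (Aut s) (representations s t)"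
  proof (rule bij_betwI[where g = "\<lambda>b. b ** a'"])
    show "(\<lambda>b. b ** a) \<in> Aut s \<rightarrow> representations s t"
      using a by (auto simp: Aut_def representations_def gl_conj_mult invertible_int_mult)
    have "gl_conj a' t = s"
      using a'(1) by (simp add: a(2) gl_conj_mat_1 flip: gl_conj_mult)
    then show "(\<lambda>b. b ** a') \<in> representations s t \<rightarrow> Aut s"
      using inv by (auto simp: Aut_def representations_def gl_conj_mult invertible_int_mult)
  qed (simp_all add: a' flip: matrix_mul_assoc)
  then show ?thesis using True by (simp add: delta'_def bij_betw_same_card)
next
  case False
  then have "representations s t = {}" by (auto simp: representations_def)
  then show ?thesis using False by (auto simp: delta'_def)
qed

text \<open>Adding the sum over cosets to itself gives the sum over GL(g, Z), one copy for each sign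
  of a; grouping by a^T s a then yields the coefficients.\<close>

lemma has_sum_parabolic_part:
  fixes s :: "real^'n^'n"
  assumes s: "s \<in> half_integral_pos_def"
    and summable: "(\<lambda>C. tr_char (gl_conj (block_a (coset_rep C)) s) z) summable_on parabolic_cosets"
    and nz: "\<And>t. tr_char t z \<noteq> 0"
  shows "((\<lambda>t. of_real (real (card (representations s t)) / 2) * tr_char t z) has_sum
     (\<Sum>\<^sub>\<infinity>C\<in>parabolic_cosets. tr_char (gl_conj (block_a (coset_rep C)) s) z)) half_integral_pos_def"
proof -
  let ?F = "\<Sum>\<^sub>\<infinity>C\<in>parabolic_cosets. tr_char (gl_conj (block_a (coset_rep C)) s) z"
  let ?g = "\<lambda>a. tr_char (gl_conj a s) z"
  have F: "((\<lambda>C. ?g (block_a (coset_rep C))) has_sum ?F) parabolic_cosets"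
    using summable by (rule has_sum_infsum)
  have inj: "inj_on (\<lambda>C. - block_a (coset_rep C)) (parabolic_cosets :: (int^('n + 'n)^('n + 'n)) set set)"
    using inj_on_parabolic_block_a by (auto simp: inj_on_def)
  have "(?g has_sum ?F) ((\<lambda>C. block_a (coset_rep C)) ` parabolic_cosets)"
    using F by (subst has_sum_reindex[OF inj_on_parabolic_block_a]) (simp add: o_def)
  moreover have "(?g has_sum ?F) ((\<lambda>C. - block_a (coset_rep C)) ` parabolic_cosets)"
    using F by (subst has_sum_reindex[OF inj]) (simp add: o_def gl_conj_uminus)
  ultimately have "(?g has_sum (?F + ?F)) {a. invertible a}"
    unfolding GL_int_eq by (rule has_sum_Un_disjoint) (rule parabolic_block_a_disjoint)
  moreover have "bij_betw (\<lambda>(t, a). a) (Sigma half_integral_pos_def (representations s)) {a. invertible a}"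
    by (rule bij_betwI[where g = "\<lambda>a. (gl_conj a s, a)"])
       (auto simp: representations_def gl_conj_half_integral[OF s])
  ultimately have "((\<lambda>p. ?g (case p of (t, a) \<Rightarrow> a)) has_sum (?F + ?F)) (Sigma half_integral_pos_def (representations s))"
    by (subst has_sum_reindex_bij_betw)
  then have hs: "((\<lambda>(t, a). tr_char t z) has_sum (?F + ?F)) (Sigma half_integral_pos_def (representations s))"
    by (rule has_sum_cong[THEN iffD1, rotated]) (auto simp: representations_def)
  \<comment> \<open>On each fibre the summand is a nonzero constant, so summability of the whole
    family makes the fibre finite.\<close>
  have fin: "finite (representations s t)" if t: "t \<in> half_integral_pos_def" for t
  proof (rule ccontr)
    assume inf: "infinite (representations s t)"
    have "(\<lambda>(t, a). tr_char t z) summable_on Pair t ` representations s t"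
      using has_sum_imp_summable[OF hs] by (rule summable_on_subset_banach) (use t in auto)
    then have "(\<lambda>a. tr_char t z) summable_on representations s t"
      by (subst (asm) summable_on_reindex) (auto simp: o_def inj_on_def)
    then have "(\<lambda>a. norm (tr_char t z)) summable_on representations s t"
      by (simp only: summable_on_iff_abs_summable_on_complex)
    then show False
      using infsum_diverge_constant[OF inf, of "norm (tr_char t z)"] nz by simp
  qed
  have "((\<lambda>t. of_nat (card (representations s t)) * tr_char t z) has_sum (?F + ?F)) half_integral_pos_def"
    using hs by (rule has_sum_SigmaD) (simp add: fin)
  from has_sum_cmult_right[OF this, of "1 / 2"] show ?thesis by simp
qed

section \<open>Convergence of the Fourier coefficients\<close>

lemma norm_poincare_term_add:
  "norm (poincare_term s (m + n) M z) =
     norm (poincare_term s m M z) / norm (det (automorphy_matrix M z)) ^ n"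
  by (simp add: norm_poincare_term power_add)

lemma norm_tr_char_half_space_point:
  "transpose x = x \<Longrightarrow> norm (tr_char t (half_space_point l x)) = exp (- 2 * pi * l * trace t)"
  by (simp add: tr_char_half_space_point norm_mult)

text \<open>The exponential is the modulus of the character of \<open>t\<close> at height 2, and
  \<open>B\<close> is the total weight of the cosets with c nonzero; it depends neither on
  \<open>k\<close> nor on \<open>t\<close>.\<close>

lemma poincare_coeff_bound:
  fixes s :: "real^'n^'n" and p :: "nat \<Rightarrow> real^'n^'n \<Rightarrow> complex"
  assumes s: "s \<in> half_integral_pos_def"
    and p: "\<And>k. even k \<Longrightarrow> k > 2 * CARD('n) \<Longrightarrow> has_fourier_expansion (poincare_series s k) (p k)"
  obtains B where "\<And>k t. even k \<Longrightarrow> k > 2 * CARD('n) \<Longrightarrow> k \<ge> 4 * CARD('n)\<^sup>2 \<Longrightarrow> t \<in> half_integral_pos_def \<Longrightarrow>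
    norm (p k t - of_real (real (card (representations s t)) / 2)) * exp (- 4 * pi * trace t)
      \<le> B * (1 / 2) ^ (k - 4 * CARD('n)\<^sup>2)"
proof -
  define m where "m = 4 * CARD('n)\<^sup>2"
  define z where "z x = half_space_point 2 (x :: real^'n^'n)" for x
  define r where "r t = complex_of_real (real (card (representations s t)) / 2)" for t
  let ?A = "half_integral_pos_def :: (real^'n^'n) set"
  let ?Q = "Sp_int // left_coset_rel :: (int^('n + 'n)^('n + 'n)) set set"
  let ?P = "parabolic_cosets :: (int^('n + 'n)^('n + 'n)) set set"
  have pd: "pos_def_matrix s" using s by (simp add: half_integral_pos_def_def)
  obtain K where K: "K \<ge> 0" "\<And>M x l. M \<in> Sp_int \<Longrightarrow> transpose x = x \<Longrightarrow> (\<And>i j. \<bar>x $ i $ j\<bar> \<le> 1) \<Longrightarrow> l \<ge> 1 \<Longrightarrow>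
      norm (poincare_term s m M (half_space_point l x)) \<le> K * pair_weight (block_c M) (block_d M)"
    using norm_poincare_term_le_pair_weight[OF pd] unfolding m_def by metis
  define W where "W C = K * pair_weight (block_c (coset_rep C)) (block_d (coset_rep C))"
    for C :: "(int^('n + 'n)^('n + 'n)) set"
  have PQ: "?P \<subseteq> ?Q" by (auto simp: parabolic_cosets_def)
  have Wsum: "W summable_on X" if "X \<subseteq> ?Q" for X
    using summable_on_cmult_right[OF pair_weight_summable_on_cosets, of K] that
    unfolding W_def by (rule summable_on_subset_banach)
  have bound: "norm (poincare_term s m (coset_rep C) (z x)) \<le> W C"
    if "C \<in> ?Q" "transpose x = x" "\<And>i j. \<bar>x $ i $ j\<bar> \<le> 1" for C x
    unfolding W_def z_def by (rule K(2)[OF coset_rep_in(2)[OF that(1)] that(2,3)]) auto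
  have bound_par: "norm (poincare_term s k (coset_rep C) (z x)) \<le> W C"
    if C: "C \<in> ?P" and "transpose x = x" "\<And>i j. \<bar>x $ i $ j\<bar> \<le> 1" and k: "k \<ge> m" for C x k
  proof -
    have "coset_rep C \<in> Sp_int" "block_c (coset_rep C) = 0"
      using C coset_rep_in(2) by (auto simp: parabolic_cosets_def)
    then have "norm (det (automorphy_matrix (coset_rep C) (z x))) = 1"
      using det_automorphy_parabolic[of "coset_rep C" "z x"] by auto
    then show ?thesis
      using norm_poincare_term_add[of s m "k - m" "coset_rep C" "z x"] k bound[of C x] that PQ by auto
  qed
  have bound_nonpar: "norm (poincare_term s k (coset_rep C) (z x)) \<le> W C * (1 / 2) ^ (k - m)"
    if C: "C \<in> ?Q - ?P" and x: "transpose x = x" "\<And>i j. \<bar>x $ i $ j\<bar> \<le> 1" and k: "k \<ge> m" for C x k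
  proof -
    have "2 \<le> norm (det (automorphy_matrix (coset_rep C) (z x)))"
      unfolding z_def using C coset_rep_in(2) x(1)
      by (intro norm_det_automorphy_ge) (auto simp: parabolic_cosets_def)
    then have "1 / norm (det (automorphy_matrix (coset_rep C) (z x))) ^ (k - m) \<le> 1 / 2 ^ (k - m)"
      by (intro frac_le power_mono) auto
    then have "norm (poincare_term s m (coset_rep C) (z x)) * (1 / norm (det (automorphy_matrix (coset_rep C) (z x))) ^ (k - m))
        \<le> W C * (1 / 2 ^ (k - m))"
      using C x K(1) pair_weight_nonneg
      by (intro mult_mono bound) (auto simp: W_def intro!: mult_nonneg_nonneg)
    then show ?thesis
      using norm_poincare_term_add[of s m "k - m" "coset_rep C" "z x"] k
      by (simp add: power_one_over)
  qed
  have par_eq: "poincare_term s k (coset_rep C) (z x) = tr_char (gl_conj (block_a (coset_rep C)) s) (z x)"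
    if "C \<in> ?P" "even k" for C x k
    using that coset_rep_in(2) by (intro poincare_term_parabolic[OF s]) (auto simp: parabolic_cosets_def)
  define F0 where "F0 x = (\<Sum>\<^sub>\<infinity>C\<in>?P. tr_char (gl_conj (block_a (coset_rep C)) s) (z x))" for x
  have F0: "((\<lambda>t. r t * tr_char t (z x)) has_sum F0 x) ?A" if x: "transpose x = x" for x
    unfolding r_def F0_def
  proof (rule has_sum_parabolic_part[OF s])
    show "tr_char t (z x) \<noteq> 0" for t
      by (simp add: z_def tr_char_half_space_point x)
    \<comment> \<open>The modulus of the character does not see x, so the bound at
      \<open>x = 0\<close>, which lies in the bounded range, serves for every x.\<close>
    have "norm (tr_char (gl_conj (block_a (coset_rep C)) s) (z x)) \<le> W C" if "C \<in> ?P" for C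
    proof -
      have "norm (tr_char (gl_conj (block_a (coset_rep C)) s) (z x)) = norm (tr_char (gl_conj (block_a (coset_rep C)) s) (z 0))"
        by (simp add: z_def norm_tr_char_half_space_point x transpose_0)
      also have "\<dots> \<le> W C"
        using par_eq[OF that, of m 0] bound_par[OF that, of 0 m] by (simp add: m_def transpose_0)
      finally show ?thesis .
    qed
    then have "(\<lambda>C. norm (tr_char (gl_conj (block_a (coset_rep C)) s) (z x))) summable_on ?P"
      by (intro summable_on_comparison_test[OF Wsum[OF PQ]]) auto
    then show "(\<lambda>C. tr_char (gl_conj (block_a (coset_rep C)) s) (z x)) summable_on ?P"
      by (rule Infinite_Sum.abs_summable_summable)
  qed
  define B where "B = (\<Sum>\<^sub>\<infinity>C\<in>?Q - ?P. W C)"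
  have "norm (p k t - r t) * exp (- 4 * pi * trace t) \<le> B * (1 / 2) ^ (k - m)"
    if k: "even k" "k > 2 * CARD('n)" "k \<ge> m" and t: "t \<in> ?A" for k t
  proof -
    define G where "G x = poincare_series s k (z x) - F0 x" for x
    have hsG: "((\<lambda>t. (p k t - r t) * tr_char t (z x)) has_sum G x) ?A" if x: "transpose x = x" for x
    proof -
      have "((\<lambda>t. p k t * tr_char t (z x)) has_sum poincare_series s k (z x)) ?A"
        using p[OF k(1,2)] half_space_point_in[OF x, of 2] by (simp add: has_fourier_expansion_def z_def)
      moreover have "((\<lambda>t. - (r t * tr_char t (z x))) has_sum - F0 x) ?A"
        using F0[OF x] by (simp add: has_sum_uminus)
      ultimately have "((\<lambda>t. p k t * tr_char t (z x) + - (r t * tr_char t (z x))) has_sum G x) ?A"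
        unfolding G_def diff_conv_add_uminus by (rule has_sum_add)
      then show ?thesis by (simp add: left_diff_distrib)
    qed
    have G_small: "norm (G x) \<le> B * (1 / 2) ^ (k - m)"
      if x: "transpose x = x" "\<And>i j. \<bar>x $ i $ j\<bar> \<le> 1" for x
    proof -
      let ?f = "\<lambda>C. poincare_term s k (coset_rep C) (z x)"
      have "(\<lambda>C. norm (?f C)) summable_on ?P"
        using bound_par[OF _ x k(3)] by (intro summable_on_comparison_test[OF Wsum[OF PQ]]) auto
      then have sP: "?f summable_on ?P" by (rule Infinite_Sum.abs_summable_summable)
      have WN: "((\<lambda>C. W C * (1 / 2) ^ (k - m)) has_sum B * (1 / 2) ^ (k - m)) (?Q - ?P)"
        unfolding B_def by (intro has_sum_cmult_left has_sum_infsum Wsum) auto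
      have "(\<lambda>C. norm (?f C)) summable_on ?Q - ?P"
        using bound_nonpar[OF _ x k(3)]
        by (intro summable_on_comparison_test[OF has_sum_imp_summable[OF WN]]) auto
      then have sN: "?f summable_on ?Q - ?P" by (rule Infinite_Sum.abs_summable_summable)
      have "poincare_series s k (z x) = (\<Sum>\<^sub>\<infinity>C\<in>?P \<union> (?Q - ?P). ?f C)"
        unfolding poincare_series_eq using PQ by (simp add: Un_absorb1)
      also have "\<dots> = (\<Sum>\<^sub>\<infinity>C\<in>?P. ?f C) + (\<Sum>\<^sub>\<infinity>C\<in>?Q - ?P. ?f C)"
        by (rule infsum_Un_disjoint[OF sP sN]) auto
      also have "(\<Sum>\<^sub>\<infinity>C\<in>?P. ?f C) = F0 x"
        unfolding F0_def using par_eq k(1) by (intro infsum_cong)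
      finally have "G x = (\<Sum>\<^sub>\<infinity>C\<in>?Q - ?P. ?f C)" by (simp add: G_def)
      then show ?thesis
        using norm_infsum_le[OF has_sum_infsum[OF sN] WN bound_nonpar[OF _ x k(3)]] by simp
    qed
    have G_bound: "norm (G x) \<le> B * (1 / 2) ^ (k - m)" if x: "transpose x = x" for x
    proof -
      define y where "y = map_matrix frac x"
      have y: "transpose y = y" unfolding y_def by (metis map_matrix_transpose x)
      \<comment> \<open>Termwise periodicity gives the expansions at \<open>x\<close> and
        \<open>y\<close> the same summands, so uniqueness of sums yields \<open>G x = G y\<close>
        and the bound on the unit box extends to all symmetric x.\<close>
      have "((\<lambda>t. (p k t - r t) * tr_char t (z x)) has_sum G y) ?A"
        using hsG[OF y]
        by (rule has_sum_cong[THEN iffD1, rotated]) (simp add: y_def z_def tr_char_half_space_point_frac x)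
      then have "G x = G y" using hsG[OF x] has_sum_unique by blast
      moreover have "\<bar>y $ i $ j\<bar> \<le> 1" for i j
        using frac_lt_1[of "x $ i $ j"] by (simp add: y_def)
      ultimately show ?thesis using G_small[OF y] by simp
    qed
    \<comment> \<open>The height-dependent factor of the character is absorbed into the coefficient,
      which leaves a pure character of x on the space of symmetric matrices.\<close>
    have "norm ((p k t - r t) * of_real (exp (- 4 * pi * trace t))) \<le> B * (1 / 2) ^ (k - m)"
    proof (rule norm_coeff_le[where V = "{x :: real^'n^'n. transpose x = x}" and A = ?A and G = G])
      show "subspace {x :: real^'n^'n. transpose x = x}"
        by (auto simp: subspace_def transpose_def vec_eq_iff)
      show "?A \<subseteq> {x. transpose x = x}" by (auto simp: half_integral_pos_def_def pos_def_matrix_def)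
      show "((\<lambda>u. (p k u - r u) * of_real (exp (- 4 * pi * trace u)) * cis (2 * pi * (u \<bullet> x))) has_sum G x) ?A"
        if "x \<in> {x. transpose x = x}" for x
        using hsG[of x] that by (simp add: z_def tr_char_half_space_point mult.assoc)
    qed (use t G_bound in auto)
    then show ?thesis by (simp add: norm_mult)
  qed
  then show thesis using that[of B] by (simp add: m_def r_def)
qed

theorem theorem3p1:
  fixes s t :: "real^'n^'n"
    and p :: "nat \<Rightarrow> real^'n^'n \<Rightarrow> complex"
  assumes "s \<in> half_integral_pos_def" and "t \<in> half_integral_pos_def"
    and "\<And>k. even k \<Longrightarrow> k > 2 * CARD('n) \<Longrightarrow> has_fourier_expansion (poincare_series s k) (p k)"
  shows "((\<lambda>k. p k t) \<longlongrightarrow> of_real (delta' s t * real (card (Aut s)) / 2))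
           (inf sequentially (principal {k. even k}))"
proof -
  define m where "m = 4 * CARD('n)\<^sup>2"
  obtain B where B: "\<And>k t. even k \<Longrightarrow> k > 2 * CARD('n) \<Longrightarrow> k \<ge> m \<Longrightarrow> t \<in> half_integral_pos_def \<Longrightarrow>
    norm (p k t - of_real (real (card (representations s t)) / 2)) * exp (- 4 * pi * trace t)
      \<le> B * (1 / 2) ^ (k - m)"
    using poincare_coeff_bound[OF assms(1,3)] unfolding m_def by blast
  let ?L = "complex_of_real (delta' s t * real (card (Aut s)) / 2)"
  have "((\<lambda>k. p k t - ?L) \<longlongrightarrow> 0) (inf sequentially (principal {k. even k}))"
  proof (rule Lim_null_comparison)
    have "\<forall>\<^sub>F k in sequentially. even k \<longrightarrow>
        norm (p k t - ?L) \<le> (B * exp (4 * pi * trace t)) * (1 / 2) ^ (k - m)"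
      using eventually_ge_at_top[of m] eventually_gt_at_top[of "2 * CARD('n)"]
    proof eventually_elim
      case (elim k)
      show ?case
      proof
        assume "even k"
        then have "norm (p k t - ?L) * exp (- 4 * pi * trace t) \<le> B * (1 / 2) ^ (k - m)"
          using B[of k t] elim assms(2) by (simp add: card_representations)
        then show "norm (p k t - ?L) \<le> (B * exp (4 * pi * trace t)) * (1 / 2) ^ (k - m)"
          by (simp add: exp_minus field_simps)
      qed
    qed
    then show "\<forall>\<^sub>F k in inf sequentially (principal {k. even k}).
        norm (p k t - ?L) \<le> (B * exp (4 * pi * trace t)) * (1 / 2) ^ (k - m)"
      by (simp add: eventually_inf_principal)
    have "(\<lambda>k. (1 / 2 :: real) ^ k) \<longlonglongrightarrow> 0"
      by (rule LIMSEQ_power_zero) simp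
    \<comment> \<open>The truncated difference \<open>k - m\<close> is an honest one for
      \<open>k >= m\<close>, and a shift of the index does not affect the limit.\<close>
    then have "(\<lambda>k. (1 / 2 :: real) ^ (k - m)) \<longlonglongrightarrow> 0"
      by (intro LIMSEQ_offset[where k = m and f = "\<lambda>k. (1 / 2) ^ (k - m)"]) simp
    then have "(\<lambda>k. (B * exp (4 * pi * trace t)) * (1 / 2) ^ (k - m)) \<longlonglongrightarrow> 0"
      by (rule tendsto_mult_right_zero)
    then show "((\<lambda>k. (B * exp (4 * pi * trace t)) * (1 / 2) ^ (k - m)) \<longlongrightarrow> 0)
        (inf sequentially (principal {k. even k}))"
      by (rule tendsto_mono[OF inf_le1])
  qed
  then show ?thesis by (simp add: Lim_null[symmetric])
qed

end
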